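(* Let $\Delta$ be a right-angled building, let $c_0\in\mathrm{Ch}(\Delta)$ and let $n\in\mathbb{N}$. The square closure of the ball $\mathsf{B}(c_0,n)$ with respect to $c_0$ is $\mathrm{Flex}(c_0,n)$. Moreover, the set $\mathrm{Flex}(c_0,n)$ is bounded (i.e. has finite diameter for the gallery distance).
   Context: A Coxeter system $(W,S)$ ($S$ finite) is right-angled if all entries of its Coxeter matrix are $1,2$ or $\infty$; $l$ is the word length on $W$ and $|st|$ is the order of $st$. A chamber system with index set $S$ is an edge-colored graph with color set $S$ such that for each $s\in S$ every $s$-panel (connected component of the graph formed by the edges of color $s$) is a complete graph with at least two vertices; vertices are called chambers, and $c\overset{s}{\sim}d$ means that $c,d$ are joined by an edge of color $s$. A right-angled building of type $(W,S)$ is a chamber system $\Delta$ with index set $S$ together with a map (Weyl distance) $\delta\colon \mathrm{Ch}(\Delta)\times\mathrm{Ch}(\Delta)\to W$, where $(W,S)$ is a right-angled Coxeter system, such that for every reduced word $w$ representing $\overline{w}\in W$: $\delta(c_1,c_2)=\overline{w}$ iff there is a gallery (path) of type $w$ (sequence of colors) from $c_1$ to $c_2$. The gallery distance is $d_W(c_1,c_2)=l(\delta(c_1,c_2))$; $\mathsf{S}(c_0,n)$ and $\mathsf{B}(c_0,n)$ are the sets of chambers at gallery distance exactly $n$, respectively at most $n$, from $c_0$. An element $w\in W$ is firm if every reduced word representing it ends with the same letter; equivalently there is a unique $r\in S$ with $l(wr)<l(w)$. A chamber $c$ is firm with respect to $c_0$ if $\delta(c_0,c)$ is firm. A chamber $c$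 at distance $k>n$ from $c_0$ is $n$-flexible with respect to $c_0$ if for each minimal gallery $(c_0,c_1,\dots,c_k=c)$ from $c_0$ to $c$, none of the chambers $c_{n+1},\dots,c_k$ is firm with respect to $c_0$; by convention all chambers of $\mathsf{B}(c_0,n)$ are $n$-flexible. $\mathrm{Flex}(c_0,n)$ is the set of all chambers that are $n$-flexible with respect to $c_0$. A set $\mathscr{C}\subseteq\mathrm{Ch}(\Delta)$ is closed under squares with respect to $c_0$ if for each $m$ the following holds: if $c_1,c_2\in\mathscr{C}\cap\mathsf{S}(c_0,m)$ and $c_4\in\mathscr{C}\cap\mathsf{S}(c_0,m-1)$ are such that $c_4\overset{s_i}{\sim}c_1$ and $c_4\overset{s_j}{\sim}c_2$ for some $s_i\ne s_j$ in $S$ with $|s_is_j|=2$, then the unique chamber $c_3\in\mathsf{S}(c_0,m+1)$ with $c_3\overset{s_j}{\sim}c_1$ and $c_3\overset{s_i}{\sim}c_2$ is also in $\mathscr{C}$. The square closure of $\mathscr{C}$ with respect to $c_0$ is the smallest subset of $\mathrm{Ch}(\Delta)$ containing $\mathscr{C}$ and closed under squares with respect to $c_0$. *)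

theory Defs
  imports "HOL-Algebra.Multiplicative_Group" "HOL-Algebra.Generated_Groups"
begin

section \<open>Right-angled Coxeter systems\<close>

definition word_prod :: "('w, 'm) monoid_scheme \<Rightarrow> 'w list \<Rightarrow> 'w" where
  "word_prod W ws = foldr (\<otimes>\<^bsub>W\<^esub>) ws \<one>\<^bsub>W\<^esub>"

text \<open>
  The congruence on words over \<open>S\<close> that is generated by \<open>(s t)^m = 1\<close>, where \<open>m\<close> is the order of
  \<open>s t\<close>.  As \<open>group.ord\<close> is \<open>0\<close> for elements of infinite order, those pairs contribute no
  relation.  The case \<open>s = t\<close> gives \<open>s s = 1\<close>, so that formal inverses of letters are not needed
  and the quotient of the free monoid is the group presented by these relations.
\<close>

inductive coxeter_cong :: "('w, 'm) monoid_scheme \<Rightarrow> 'w set \<Rightarrow> 'w list \<Rightarrow> 'w list \<Rightarrow> bool"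
  for W S where
  refl: "set u \<subseteq> S \<Longrightarrow> coxeter_cong W S u u"
| relation: "\<lbrakk>set u \<subseteq> S; set v \<subseteq> S; s \<in> S; t \<in> S\<rbrakk> \<Longrightarrow>
    coxeter_cong W S (u @ concat (replicate (group.ord W (s \<otimes>\<^bsub>W\<^esub> t)) [s, t]) @ v) (u @ v)"
| sym: "coxeter_cong W S u v \<Longrightarrow> coxeter_cong W S v u"
| trans: "\<lbrakk>coxeter_cong W S u v; coxeter_cong W S v w\<rbrakk> \<Longrightarrow> coxeter_cong W S u w"

locale coxeter_system = group W for W (structure) +
  fixes S
  assumes finite_gens: "finite S"
    and gens_closed: "S \<subseteq> carrier W"
    and gens_order: "s \<in> S \<Longrightarrow> ord s = 2"
    and gens_generate: "generate W S = carrier W"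
    and presentation:
      "\<lbrakk>set u \<subseteq> S; set v \<subseteq> S; word_prod W u = word_prod W v\<rbrakk> \<Longrightarrow> coxeter_cong W S u v"

text \<open>The value \<open>0\<close> of \<open>ord\<close> stands for the entry \<open>\<infinity>\<close> of the Coxeter matrix.\<close>

locale right_angled_coxeter_system = coxeter_system +
  assumes right_angled: "\<lbrakk>s \<in> S; t \<in> S\<rbrakk> \<Longrightarrow> ord (s \<otimes> t) \<in> {0, 1, 2}"

definition word_length :: "('w, 'm) monoid_scheme \<Rightarrow> 'w set \<Rightarrow> 'w \<Rightarrow> nat" where
  "word_length W S x = (LEAST k. \<exists>ws. set ws \<subseteq> S \<and> word_prod W ws = x \<and> length ws = k)"

definition reduced_word :: "('w, 'm) monoid_scheme \<Rightarrow> 'w set \<Rightarrow> 'w list \<Rightarrow> bool" where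
  "reduced_word W S ws \<longleftrightarrow> set ws \<subseteq> S \<and> length ws = word_length W S (word_prod W ws)"

text \<open>The identity is not firm: it is represented by the empty word, which has no last letter.\<close>

definition firm :: "('w, 'm) monoid_scheme \<Rightarrow> 'w set \<Rightarrow> 'w \<Rightarrow> bool" where
  "firm W S x \<longleftrightarrow>
    (\<exists>r\<in>S. \<forall>ws. reduced_word W S ws \<and> word_prod W ws = x \<longrightarrow> ws \<noteq> [] \<and> last ws = r)"


section \<open>Chamber systems\<close>

record ('c, 'w) coloured_graph =
  chambers :: "'c set"
  edges :: "'c set set"
  colour :: "'c set \<Rightarrow> 'w"

definition adjacent :: "('c, 'w, 'm) coloured_graph_scheme \<Rightarrow> 'w \<Rightarrow> 'c \<Rightarrow> 'c \<Rightarrow> bool" where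
  "adjacent \<Delta> s c d \<longleftrightarrow> {c, d} \<in> edges \<Delta> \<and> colour \<Delta> {c, d} = s"

definition panel :: "('c, 'w, 'm) coloured_graph_scheme \<Rightarrow> 'w \<Rightarrow> 'c \<Rightarrow> 'c set" where
  "panel \<Delta> s c = {d. (adjacent \<Delta> s)\<^sup>*\<^sup>* c d}"

locale chamber_system =
  fixes \<Delta> and S
  assumes edges: "edges \<Delta> \<subseteq> {{c, d} |c d. c \<in> chambers \<Delta> \<and> d \<in> chambers \<Delta> \<and> c \<noteq> d}"
    and colours: "colour \<Delta> ` edges \<Delta> \<subseteq> S"
    and panel_complete: "\<lbrakk>s \<in> S; c \<in> chambers \<Delta>; x \<in> panel \<Delta> s c; y \<in> panel \<Delta> s c; x \<noteq> y\<rbrakk>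
      \<Longrightarrow> adjacent \<Delta> s x y"
    and panel_two: "\<lbrakk>s \<in> S; c \<in> chambers \<Delta>\<rbrakk>
      \<Longrightarrow> \<exists>x\<in>panel \<Delta> s c. \<exists>y\<in>panel \<Delta> s c. x \<noteq> y"

definition gallery ::
    "('c, 'w, 'm) coloured_graph_scheme \<Rightarrow> 'w list \<Rightarrow> 'c list \<Rightarrow> 'c \<Rightarrow> 'c \<Rightarrow> bool" where
  "gallery \<Delta> ws cs c d \<longleftrightarrow>
    set cs \<subseteq> chambers \<Delta> \<and> length cs = length ws + 1 \<and> hd cs = c \<and> last cs = d \<and>
    (\<forall>i<length ws. adjacent \<Delta> (ws ! i) (cs ! i) (cs ! (i + 1)))"


section \<open>Right-angled buildings\<close>

record ('c, 'w) building = "('c, 'w) coloured_graph" +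
  weyl :: "'w monoid"
  gens :: "'w set"
  wdist :: "'c \<Rightarrow> 'c \<Rightarrow> 'w"

locale right_angled_building =
  right_angled_coxeter_system "weyl \<Delta>" "gens \<Delta>" + chamber_system \<Delta> "gens \<Delta>"
  for \<Delta> :: "('c, 'w) building" +
  assumes wdist_closed:
      "\<lbrakk>c \<in> chambers \<Delta>; d \<in> chambers \<Delta>\<rbrakk> \<Longrightarrow> wdist \<Delta> c d \<in> carrier (weyl \<Delta>)"
    and wdist_gallery:
      "\<lbrakk>c \<in> chambers \<Delta>; d \<in> chambers \<Delta>; reduced_word (weyl \<Delta>) (gens \<Delta>) ws\<rbrakk> \<Longrightarrow>
        wdist \<Delta> c d = word_prod (weyl \<Delta>) ws \<longleftrightarrow> (\<exists>cs. gallery \<Delta> ws cs c d)"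

definition gallery_dist :: "('c, 'w) building \<Rightarrow> 'c \<Rightarrow> 'c \<Rightarrow> nat" where
  "gallery_dist \<Delta> c d = word_length (weyl \<Delta>) (gens \<Delta>) (wdist \<Delta> c d)"

definition gallery_sphere :: "('c, 'w) building \<Rightarrow> 'c \<Rightarrow> nat \<Rightarrow> 'c set" where
  "gallery_sphere \<Delta> c\<^sub>0 n = {c \<in> chambers \<Delta>. gallery_dist \<Delta> c\<^sub>0 c = n}"

definition gallery_ball :: "('c, 'w) building \<Rightarrow> 'c \<Rightarrow> nat \<Rightarrow> 'c set" where
  "gallery_ball \<Delta> c\<^sub>0 n = {c \<in> chambers \<Delta>. gallery_dist \<Delta> c\<^sub>0 c \<le> n}"

definition gallery_bounded :: "('c, 'w) building \<Rightarrow> 'c set \<Rightarrow> bool" where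
  "gallery_bounded \<Delta> C \<longleftrightarrow> (\<exists>N. \<forall>c\<in>C. \<forall>d\<in>C. gallery_dist \<Delta> c d \<le> N)"

definition minimal_gallery :: "('c, 'w) building \<Rightarrow> 'c list \<Rightarrow> 'c \<Rightarrow> 'c \<Rightarrow> bool" where
  "minimal_gallery \<Delta> cs c d \<longleftrightarrow>
    (\<exists>ws. gallery \<Delta> ws cs c d \<and> length ws = gallery_dist \<Delta> c d)"

definition firm_chamber :: "('c, 'w) building \<Rightarrow> 'c \<Rightarrow> 'c \<Rightarrow> bool" where
  "firm_chamber \<Delta> c\<^sub>0 c \<longleftrightarrow> firm (weyl \<Delta>) (gens \<Delta>) (wdist \<Delta> c\<^sub>0 c)"

definition flexible :: "('c, 'w) building \<Rightarrow> 'c \<Rightarrow> nat \<Rightarrow> 'c \<Rightarrow> bool" where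
  "flexible \<Delta> c\<^sub>0 n c \<longleftrightarrow>
    c \<in> gallery_ball \<Delta> c\<^sub>0 n \<or>
    c \<in> chambers \<Delta> \<and> gallery_dist \<Delta> c\<^sub>0 c > n \<and>
    (\<forall>cs. minimal_gallery \<Delta> cs c\<^sub>0 c \<longrightarrow>
      (\<forall>i\<in>{n + 1..gallery_dist \<Delta> c\<^sub>0 c}. \<not> firm_chamber \<Delta> c\<^sub>0 (cs ! i)))"

definition Flex :: "('c, 'w) building \<Rightarrow> 'c \<Rightarrow> nat \<Rightarrow> 'c set" where
  "Flex \<Delta> c\<^sub>0 n = {c. flexible \<Delta> c\<^sub>0 n c}"

text \<open>
  In a right-angled building the fourth chamber \<open>c\<^sub>3\<close> of the square exists and is unique, so
  quantifying over all such \<open>c\<^sub>3\<close> refers to exactly one chamber.  There is no condition for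
  \<open>m = 0\<close>, where the sphere of radius \<open>m - 1\<close> is empty.
\<close>

definition closed_under_squares :: "('c, 'w) building \<Rightarrow> 'c \<Rightarrow> 'c set \<Rightarrow> bool" where
  "closed_under_squares \<Delta> c\<^sub>0 C \<longleftrightarrow>
    (\<forall>m\<ge>1. \<forall>s\<in>gens \<Delta>. \<forall>t\<in>gens \<Delta>.
      \<forall>c\<^sub>1 \<in> C \<inter> gallery_sphere \<Delta> c\<^sub>0 m. \<forall>c\<^sub>2 \<in> C \<inter> gallery_sphere \<Delta> c\<^sub>0 m.
      \<forall>c\<^sub>4 \<in> C \<inter> gallery_sphere \<Delta> c\<^sub>0 (m - 1). \<forall>c\<^sub>3 \<in> gallery_sphere \<Delta> c\<^sub>0 (m + 1).
        s \<noteq> t \<and> group.ord (weyl \<Delta>) (s \<otimes>\<^bsub>weyl \<Delta>\<^esub> t) = 2 \<and>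
        adjacent \<Delta> s c\<^sub>4 c\<^sub>1 \<and> adjacent \<Delta> t c\<^sub>4 c\<^sub>2 \<and>
        adjacent \<Delta> t c\<^sub>3 c\<^sub>1 \<and> adjacent \<Delta> s c\<^sub>3 c\<^sub>2 \<longrightarrow> c\<^sub>3 \<in> C)"

definition square_closure :: "('c, 'w) building \<Rightarrow> 'c \<Rightarrow> 'c set \<Rightarrow> 'c set" where
  "square_closure \<Delta> c\<^sub>0 C = (\<lambda>D. D \<subseteq> chambers \<Delta> \<and> closed_under_squares \<Delta> c\<^sub>0 D) hull C"

end

theory Submission
  imports Defs
begin

text \<open>
  Write \<open>W\<close> for the Coxeter group of the building and \<open>S\<close> for its set of generators.
  The proof rests on the word problem for \<open>W\<close>.  A word can be shortened exactly when two
  occurrences of a letter can be brought together by exchanging commuting letters, and two reduced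
  words of the same element differ only by such exchanges (\<open>reduced_iff_normal\<close>,
  \<open>normal_trace_unique\<close>).  Hence right multiplication by \<open>t\<close> shortens an element iff \<open>t\<close> can be
  moved to the end of one (equivalently, of every) reduced word of it, and two different letters
  with this property commute.  An element other than the identity is firm iff there is only one
  such letter.

  Flexibility becomes a statement about distances: \<open>c\<close> is \<open>n\<close>-flexible iff every firm chamber \<open>e\<close>
  with \<open>d(c\<^sub>0, e) + d(e, c) = d(c\<^sub>0, c)\<close> lies in the ball of radius \<open>n\<close>
  (\<open>flexible_iff_between\<close>).  Three arguments then give the theorem.

  Flexible chambers are closed under squares (\<open>Flex_closed_under_squares\<close>).  Let \<open>c\<^sub>3\<close> be the top of
  a square with letters \<open>s\<close> and \<open>t\<close>, and let \<open>e\<close> be a firm chamber between \<open>c\<^sub>0\<close> and \<open>c\<^sub>3\<close>.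
  Concatenate reduced words \<open>u\<close> from \<open>c\<^sub>0\<close> to \<open>e\<close> and \<open>v\<close> from \<open>e\<close> to \<open>c\<^sub>3\<close>.  Both \<open>s\<close> and \<open>t\<close> can be
  moved to the end of the result, but not both come from \<open>u\<close>, because \<open>e\<close> is firm.  So one of
  them comes from \<open>v\<close>, and therefore \<open>e\<close> lies between \<open>c\<^sub>0\<close> and one of the two lower neighbours of
  \<open>c\<^sub>3\<close> in the square, which are flexible.

  Every flexible chamber outside the ball arises from squares (\<open>flexible_in_closed_set\<close>).  It is
  not firm, so two commuting letters can be moved to the end of its word and it is the top of a
  square.  The other three chambers of this square lie between \<open>c\<^sub>0\<close> and it, so they are flexible
  too, and induction on the distance applies.

  Boundedness (\<open>flexible_gdist_le\<close>) comes from counting letters.  Take a reduced word of a flexible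
  element, cut it after its last occurrence of \<open>s\<close>, and discard letters other than \<open>s\<close> from the
  end, up to exchanges, until a firm element remains.  That element contains all occurrences of
  \<open>s\<close> and has length at most \<open>n\<close>, so every letter occurs at most \<open>n\<close> times and the word has
  length at most \<open>n |S|\<close>.
\<close>

section \<open>Cancelling letters up to commutation\<close>

context monoid
begin

definition commuting :: "'a \<Rightarrow> 'a \<Rightarrow> bool" where
  "commuting s t \<longleftrightarrow> s \<noteq> t \<and> s \<otimes> t = t \<otimes> s"

lemma commuting_irrefl [simp]: "\<not> commuting s s"
  by (simp add: commuting_def)

lemma commuting_sym: "commuting s t \<longleftrightarrow> commuting t s"
  by (auto simp: commuting_def)

text \<open>
  The letter \<open>t\<close> can be moved to the end of the word by exchanging adjacent commuting letters.
\<close>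

definition cancels :: "'a \<Rightarrow> 'a list \<Rightarrow> bool" where
  "cancels t ws \<longleftrightarrow> (\<exists>p q. ws = p @ t # q \<and> (\<forall>x\<in>set q. commuting t x))"

lemma cancels_Nil [simp]: "\<not> cancels t []"
  by (simp add: cancels_def)

lemma cancels_append:
  "cancels t (u @ v) \<longleftrightarrow> cancels t v \<or> (\<forall>x\<in>set v. commuting t x) \<and> cancels t u"
proof
  assume "cancels t (u @ v)"
  then obtain p q where pq: "u @ v = p @ t # q" and q: "\<forall>x\<in>set q. commuting t x"
    by (auto simp: cancels_def)
  from pq show "cancels t v \<or> (\<forall>x\<in>set v. commuting t x) \<and> cancels t u"
    using q by (fastforce simp: cancels_def append_eq_append_conv2 append_eq_Cons_conv)
next
  assume "cancels t v \<or> (\<forall>x\<in>set v. commuting t x) \<and> cancels t u"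
  then show "cancels t (u @ v)"
  proof
    assume "cancels t v"
    then show ?thesis unfolding cancels_def by (metis append.assoc)
  next
    assume *: "(\<forall>x\<in>set v. commuting t x) \<and> cancels t u"
    then obtain p q where "u = p @ t # q" "\<forall>x\<in>set q. commuting t x"
      by (auto simp: cancels_def)
    with * have "u @ v = p @ t # (q @ v)" "\<forall>x\<in>set (q @ v). commuting t x" by auto
    then show ?thesis unfolding cancels_def by blast
  qed
qed

lemma cancels_single [simp]: "cancels t [x] \<longleftrightarrow> x = t"
  by (auto simp: cancels_def Cons_eq_append_conv)

lemma cancels_snoc: "cancels t (ws @ [x]) \<longleftrightarrow> x = t \<or> commuting t x \<and> cancels t ws"
  by (auto simp: cancels_append)

lemma cancels_Cons:
  "cancels t (x # v) \<longleftrightarrow> cancels t v \<or> (\<forall>y\<in>set v. commuting t y) \<and> x = t"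
  using cancels_append[of t "[x]" v] by simp

text \<open>
  The effect on words of multiplying by a generator \<open>t\<close>, where \<open>t t = 1\<close>, on the right.  If \<open>t\<close> can be moved to the end, the occurrence
  that can be moved is the last one; it is deleted by \<open>remove1\<close> on the reversed word.
\<close>

definition mult_letter :: "'a \<Rightarrow> 'a list \<Rightarrow> 'a list" where
  "mult_letter t ws = (if cancels t ws then rev (remove1 t (rev ws)) else ws @ [t])"

lemma mult_letter_cancel:
  assumes "\<forall>x\<in>set q. commuting t x"
  shows "mult_letter t (p @ t # q) = p @ q"
proof -
  have "t \<notin> set q" using assms by auto
  moreover have "cancels t (p @ t # q)" using assms by (auto simp: cancels_def)
  ultimately show ?thesis by (simp add: mult_letter_def remove1_append)
qed

text \<open>
  Words in which appending the letters one by one never causes a cancellation.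
\<close>

definition normal :: "'a list \<Rightarrow> bool" where
  "normal ws \<longleftrightarrow> (\<forall>p t q. ws = p @ t # q \<longrightarrow> \<not> cancels t p)"

lemma normal_Nil [simp]: "normal []"
  by (simp add: normal_def)

lemma normal_snoc: "normal (ws @ [t]) \<longleftrightarrow> normal ws \<and> \<not> cancels t ws"
proof
  assume n: "normal (ws @ [t])"
  have "\<not> cancels x p" if "ws = p @ x # q" for p x q
  proof -
    have "ws @ [t] = p @ x # (q @ [t])" using that by simp
    then show ?thesis using n unfolding normal_def by blast
  qed
  moreover have "\<not> cancels t ws" using n unfolding normal_def by blast
  ultimately show "normal ws \<and> \<not> cancels t ws" by (simp add: normal_def)
next
  assume n: "normal ws \<and> \<not> cancels t ws"
  show "normal (ws @ [t])"
    unfolding normal_def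
  proof (intro allI impI)
    fix p x q assume eq: "ws @ [t] = p @ x # q"
    show "\<not> cancels x p"
    proof (cases q rule: rev_cases)
      case Nil
      then show ?thesis using eq n by simp
    next
      case (snoc q' y)
      then have "ws = p @ x # q'" using eq by simp
      then show ?thesis using n by (simp add: normal_def)
    qed
  qed
qed

lemma normal_prefix: "normal (u @ v) \<Longrightarrow> normal u"
  by (induction v rule: rev_induct) (auto simp: normal_snoc simp flip: append_assoc)

text \<open>
  Deleting a letter \<open>t\<close> that commutes with everything behind it cannot enable a later letter \<open>x\<close> to
  cancel: since \<open>x\<close> commutes with \<open>t\<close>, the letter \<open>t\<close> did not block \<open>x\<close>.
\<close>

lemma normal_delete:
  "normal (p @ t # q) \<Longrightarrow> \<forall>x\<in>set q. commuting t x \<Longrightarrow> normal (p @ q)"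
proof (induction q rule: rev_induct)
  case Nil
  then show ?case using normal_prefix by auto
next
  case (snoc x q)
  from snoc.prems(1) have n: "normal (p @ t # q)" "\<not> cancels x (p @ t # q)"
    using normal_snoc[of "p @ t # q" x] by auto
  have "commuting x t" using snoc.prems(2) commuting_sym by auto
  then have "\<not> cancels x (p @ q)" using n(2) by (auto simp: cancels_append cancels_Cons)
  moreover have "normal (p @ q)" using snoc n by auto
  ultimately show ?case using normal_snoc[of "p @ q" x] by simp
qed

lemma normal_mult_letter:
  assumes "normal ws"
  shows "normal (mult_letter t ws)"
proof (cases "cancels t ws")
  case True
  then obtain p q where "ws = p @ t # q" "\<forall>x\<in>set q. commuting t x"
    by (auto simp: cancels_def)
  then show ?thesis using assms normal_delete by (simp add: mult_letter_cancel)
next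
  case False
  then show ?thesis using assms by (simp add: mult_letter_def normal_snoc)
qed

section \<open>Projections to pairs of letters that do not commute\<close>

definition projection :: "'a \<Rightarrow> 'a \<Rightarrow> 'a list \<Rightarrow> 'a list" where
  "projection a b = filter (\<lambda>x. x = a \<or> x = b)"

text \<open>
  Two words differ by exchanges of commuting letters iff they have the same projection to every
  pair of letters that do not commute.  The pairs \<open>(a, a)\<close> are included and record how often \<open>a\<close>
  occurs.  With projections as the definition, the commutation of independent letter operations
  holds because they act on disjoint sets of pairs.
\<close>

definition trace_eq :: "'a list \<Rightarrow> 'a list \<Rightarrow> bool" where
  "trace_eq u v \<longleftrightarrow> (\<forall>a b. \<not> commuting a b \<longrightarrow> projection a b u = projection a b v)"

lemma projection_sym: "projection a b = projection b a"
  unfolding projection_def by metis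

text \<open>
  Whether \<open>t\<close> can be moved to the end depends only on the projections, hence is invariant under
  \<open>trace_eq\<close>.  The pair \<open>(t, t)\<close> ensures that \<open>t\<close> occurs at all.
\<close>

lemma cancels_iff_projection:
  "cancels t ws \<longleftrightarrow>
    (\<forall>a. \<not> commuting t a \<longrightarrow> projection t a ws \<noteq> [] \<and> last (projection t a ws) = t)"
  (is "_ \<longleftrightarrow> ?R")
proof
  assume "cancels t ws"
  then obtain p q where ws: "ws = p @ t # q" and q: "\<forall>x\<in>set q. commuting t x"
    by (auto simp: cancels_def)
  show ?R
  proof (intro allI impI)
    fix a assume "\<not> commuting t a"
    then have "projection t a q = []" using q by (auto simp: projection_def filter_empty_conv)
    then show "projection t a ws \<noteq> [] \<and> last (projection t a ws) = t"
      by (simp add: ws projection_def)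
  qed
next
  assume R: ?R
  then have "projection t t ws \<noteq> []" by simp
  then have "t \<in> set ws" by (auto simp: projection_def filter_empty_conv)
  then obtain p q where ws: "ws = p @ t # q" and tq: "t \<notin> set q"
    using split_list_last by metis
  have "commuting t x" if x: "x \<in> set q" for x
  proof (rule ccontr)
    assume "\<not> commuting t x"
    with R have "last (projection t x ws) = t" by blast
    moreover have ne: "projection t x q \<noteq> []"
      using x by (auto simp: projection_def filter_empty_conv)
    ultimately have "last (projection t x q) = t" by (simp add: ws projection_def)
    with ne have "t \<in> set (projection t x q)" by (metis last_in_set)
    with tq show False by (simp add: projection_def)
  qed
  with ws show "cancels t ws" by (auto simp: cancels_def)
qed

lemma projection_mult_letter:
  assumes "\<not> commuting a b"
  shows "projection a b (mult_letter t ws) =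
    (if a = t \<or> b = t
     then if cancels t ws then butlast (projection a b ws) else projection a b ws @ [t]
     else projection a b ws)"
proof (cases "cancels t ws")
  case True
  then obtain p q where ws: "ws = p @ t # q" and q: "\<forall>x\<in>set q. commuting t x"
    by (auto simp: cancels_def)
  have "projection a b q = []" if "a = t \<or> b = t"
    using that q assms commuting_sym
    by (auto simp: projection_def filter_empty_conv)
  then show ?thesis
    using True by (auto simp: ws mult_letter_cancel[OF q] projection_def butlast_append)
next
  case False
  then show ?thesis by (auto simp: mult_letter_def projection_def)
qed

lemma trace_eq_refl [simp]: "trace_eq u u"
  by (simp add: trace_eq_def)

lemma trace_eq_sym: "trace_eq u v \<Longrightarrow> trace_eq v u"
  by (simp add: trace_eq_def)

lemma trace_eq_trans [trans]: "trace_eq u v \<Longrightarrow> trace_eq v w \<Longrightarrow> trace_eq u w"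
  by (simp add: trace_eq_def)

lemma trace_eq_cancels: "trace_eq u v \<Longrightarrow> cancels t u \<longleftrightarrow> cancels t v"
  by (simp add: trace_eq_def cancels_iff_projection)

lemma trace_eq_mult_letter: "trace_eq u v \<Longrightarrow> trace_eq (mult_letter t u) (mult_letter t v)"
  using trace_eq_cancels[of u v t] by (auto simp: trace_eq_def projection_mult_letter)

lemma trace_eq_count_list:
  assumes "trace_eq u v"
  shows "count_list u x = count_list v x"
proof -
  have "projection x x u = projection x x v"
    using assms by (simp add: trace_eq_def)
  moreover have "(\<lambda>y. y = x) = (=) x" by auto
  ultimately show ?thesis by (simp add: projection_def count_list_eq_length_filter)
qed

lemma trace_eq_length:
  assumes "trace_eq u v"
  shows "length u = length v"
proof -
  have "length u = (\<Sum>x\<in>set u \<union> set v. count_list u x)"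
    by (rule sum_count_set[symmetric]) auto
  also have "\<dots> = (\<Sum>x\<in>set u \<union> set v. count_list v x)"
    using trace_eq_count_list[OF assms] by simp
  also have "\<dots> = length v"
    by (rule sum_count_set) auto
  finally show ?thesis .
qed

text \<open>
  A pair of letters that do not commute contains at most one of \<open>s\<close> and \<open>t\<close>, so each projection is
  changed by at most one of the two operations, and neither affects whether the other cancels.
\<close>

lemma mult_letter_commute:
  assumes "commuting s t"
  shows "trace_eq (mult_letter s (mult_letter t ws)) (mult_letter t (mult_letter s ws))"
proof -
  have indep: "cancels x (mult_letter y ws) \<longleftrightarrow> cancels x ws" if "commuting x y" for x y
  proof -
    have "projection x a (mult_letter y ws) = projection x a ws" if "\<not> commuting x a" for a
      using that \<open>commuting x y\<close> by (auto simp: projection_mult_letter)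
    then show ?thesis by (simp add: cancels_iff_projection)
  qed
  show ?thesis
    using assms indep[of s t] indep[of t s] commuting_sym[of s t]
    by (auto simp: trace_eq_def projection_mult_letter)
qed

text \<open>
  Normality rules out that both multiplications cancel, as they do on the word \<open>[t, t]\<close>, which
  becomes empty.
\<close>

lemma mult_letter_twice:
  assumes "normal ws"
  shows "trace_eq (mult_letter t (mult_letter t ws)) ws"
proof (cases "cancels t ws")
  case True
  then obtain p q where ws: "ws = p @ t # q" and q: "\<forall>x\<in>set q. commuting t x"
    by (auto simp: cancels_def)
  have "\<not> cancels t p" using assms by (simp add: normal_def ws)
  moreover have "\<not> cancels t q" using q by (auto simp: cancels_def)
  ultimately have "\<not> cancels t (mult_letter t ws)"
    by (simp add: ws mult_letter_cancel[OF q] cancels_append)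
  moreover have "butlast (projection a b ws) @ [t] = projection a b ws"
    if "\<not> commuting a b" "a = t \<or> b = t" for a b
    using that True projection_sym[of a b] commuting_sym[of a b]
    unfolding cancels_iff_projection by (metis append_butlast_last_id)
  ultimately show ?thesis
    using True by (auto simp: trace_eq_def projection_mult_letter)
next
  case False
  then have "cancels t (mult_letter t ws)" by (simp add: mult_letter_def cancels_snoc)
  with False show ?thesis by (auto simp: trace_eq_def projection_mult_letter)
qed

text \<open>
  The action of a word on a word, starting from \<open>w\<close>; from the empty word it yields the normal form.
\<close>

definition normal_form_from :: "'a list \<Rightarrow> 'a list \<Rightarrow> 'a list" where
  "normal_form_from = foldl (\<lambda>w t. mult_letter t w)"

lemma normal_normal_form_from: "normal w \<Longrightarrow> normal (normal_form_from w ws)"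
  by (induction ws arbitrary: w) (simp_all add: normal_form_from_def normal_mult_letter)

lemma normal_form_from_append:
  "normal_form_from w (u @ v) = normal_form_from (normal_form_from w u) v"
  by (simp add: normal_form_from_def)

lemma normal_form_from_cong:
  "trace_eq w w' \<Longrightarrow> trace_eq (normal_form_from w ws) (normal_form_from w' ws)"
  by (induction ws arbitrary: w w') (simp_all add: normal_form_from_def trace_eq_mult_letter)

lemma normal_form_from_normal: "normal ws \<Longrightarrow> normal_form_from [] ws = ws"
  by (induction ws rule: rev_induct)
    (simp_all add: normal_form_from_def normal_snoc mult_letter_def)

section \<open>Products of words\<close>

lemma word_prod_Nil [simp]: "word_prod G [] = \<one>"
  by (simp add: word_prod_def)

lemma word_prod_Cons [simp]: "word_prod G (x # ws) = x \<otimes> word_prod G ws"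
  by (simp add: word_prod_def)

lemma word_prod_closed [simp]: "set ws \<subseteq> carrier G \<Longrightarrow> word_prod G ws \<in> carrier G"
  by (induction ws) auto

lemma word_prod_append [simp]:
  "set u \<subseteq> carrier G \<Longrightarrow> set v \<subseteq> carrier G \<Longrightarrow>
    word_prod G (u @ v) = word_prod G u \<otimes> word_prod G v"
  by (induction u) (auto simp: m_assoc)

lemma word_prod_commute:
  "set q \<subseteq> carrier G \<Longrightarrow> t \<in> carrier G \<Longrightarrow> \<forall>x\<in>set q. commuting t x \<Longrightarrow>
    word_prod G q \<otimes> t = t \<otimes> word_prod G q"
proof (induction q)
  case (Cons x q)
  then have "x \<otimes> word_prod G q \<otimes> t = x \<otimes> (t \<otimes> word_prod G q)" by (simp add: m_assoc)
  also have "\<dots> = t \<otimes> (x \<otimes> word_prod G q)"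
    using Cons.prems by (simp add: commuting_def flip: m_assoc)
  finally show ?case by simp
qed simp

end

section \<open>Reduced words\<close>

context coxeter_system
begin

abbreviation len :: "'a \<Rightarrow> nat" where
  "len \<equiv> word_length W S"

abbreviation reduced :: "'a list \<Rightarrow> bool" where
  "reduced \<equiv> reduced_word W S"

abbreviation wprod :: "'a list \<Rightarrow> 'a" where
  "wprod \<equiv> word_prod W"

lemma word_in_carrier: "set ws \<subseteq> S \<Longrightarrow> set ws \<subseteq> carrier W"
  using gens_closed by blast

lemma gen_in_carrier: "s \<in> S \<Longrightarrow> s \<in> carrier W"
  using gens_closed by blast

lemma gen_square: "s \<in> S \<Longrightarrow> s \<otimes> s = \<one>"
  using gens_order pow_ord_eq_1[of s] gens_closed
  by (auto simp: numeral_2_eq_2)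

lemma gen_square_cancel: "s \<in> S \<Longrightarrow> x \<in> carrier W \<Longrightarrow> s \<otimes> (s \<otimes> x) = x"
  using gen_square gens_closed by (metis l_one m_assoc subsetD)

lemma gen_square_cancel_right: "s \<in> S \<Longrightarrow> x \<in> carrier W \<Longrightarrow> x \<otimes> s \<otimes> s = x"
  using gen_square gens_closed by (metis r_one m_assoc subsetD)

lemma gen_ord_1:
  assumes "s \<in> S" "t \<in> S" "ord (s \<otimes> t) = 1"
  shows "s = t"
proof -
  have "s \<otimes> t = \<one>" using assms gens_closed ord_eq_1 by blast
  then have "s = inv t" "t = inv t"
    using assms(1,2) gens_closed gen_square by (metis inv_equality subsetD)+
  then show ?thesis by simp
qed

lemma ord_eq_2_iff_commuting:
  assumes "s \<in> S" "t \<in> S"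
  shows "ord (s \<otimes> t) = 2 \<longleftrightarrow> commuting s t"
proof
  have c: "s \<in> carrier W" "t \<in> carrier W" using assms gens_closed by auto
  {
    assume o: "ord (s \<otimes> t) = 2"
    then have "s \<otimes> t \<otimes> (s \<otimes> t) = \<one>"
      using pow_ord_eq_1[of "s \<otimes> t"] c by (simp add: numeral_2_eq_2)
    moreover have "t \<otimes> s \<otimes> (s \<otimes> t) = \<one>"
      using c assms by (simp add: m_assoc gen_square_cancel gen_square)
    ultimately have "s \<otimes> t = t \<otimes> s" using c by (metis m_closed right_cancel)
    moreover have "s \<noteq> t" using o assms gen_square by fastforce
    ultimately show "commuting s t" by (simp add: commuting_def)
  next
    assume cm: "commuting s t"
    then have "s \<otimes> t \<otimes> (s \<otimes> t) = s \<otimes> t \<otimes> (t \<otimes> s)" by (simp add: commuting_def)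
    also have "\<dots> = \<one>"
      using c assms by (simp add: m_assoc gen_square_cancel gen_square)
    finally have "(s \<otimes> t) [^] (2::nat) = \<one>" using c by (simp add: numeral_2_eq_2)
    then have dvd: "ord (s \<otimes> t) dvd 2" using c pow_eq_id by (metis m_closed)
    then have "ord (s \<otimes> t) \<le> 2" "ord (s \<otimes> t) \<noteq> 0"
      by (simp add: dvd_imp_le) (use dvd in \<open>metis dvd_0_left_iff zero_neq_numeral\<close>)
    moreover have "ord (s \<otimes> t) \<noteq> 1"
      using gen_ord_1 assms cm by (auto simp: commuting_def)
    ultimately show "ord (s \<otimes> t) = 2" by linarith
  }
qed

lemma word_exists:
  assumes "x \<in> carrier W"
  shows "\<exists>ws. set ws \<subseteq> S \<and> wprod ws = x"
proof -
  have "x \<in> generate W S" using assms gens_generate by simp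
  then show ?thesis
  proof (induction rule: generate.induct)
    case one
    then show ?case by (intro exI[of _ "[]"]) simp
  next
    case (incl h)
    then show ?case using gens_closed by (intro exI[of _ "[h]"]) auto
  next
    case (inv h)
    then have "inv h = h" using gens_closed gen_square by (metis inv_equality subsetD)
    then show ?case using inv gens_closed by (intro exI[of _ "[h]"]) auto
  next
    case (eng h1 h2)
    then obtain u v where "set u \<subseteq> S" "wprod u = h1" "set v \<subseteq> S" "wprod v = h2" by blast
    then show ?case
      using word_in_carrier by (intro exI[of _ "u @ v"]) simp
  qed
qed

lemma len_le: "set ws \<subseteq> S \<Longrightarrow> len (wprod ws) \<le> length ws"
  unfolding word_length_def by (rule Least_le) blast

lemma reduced_word_exists:
  assumes "x \<in> carrier W"
  obtains ws where "reduced ws" "wprod ws = x"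
proof -
  have "\<exists>k ws. set ws \<subseteq> S \<and> wprod ws = x \<and> length ws = k" using word_exists[OF assms] by auto
  from LeastI_ex[OF this] show ?thesis
    using that unfolding reduced_word_def word_length_def by auto
qed

lemma reduced_set: "reduced ws \<Longrightarrow> set ws \<subseteq> S"
  by (simp add: reduced_word_def)

lemma reduced_length: "reduced ws \<Longrightarrow> length ws = len (wprod ws)"
  by (simp add: reduced_word_def)

lemma wprod_delete:
  assumes "set (p @ t # q) \<subseteq> S" "\<forall>x\<in>set q. commuting t x"
  shows "wprod (p @ t # q) \<otimes> t = wprod (p @ q)"
proof -
  have c: "set p \<subseteq> carrier W" "set q \<subseteq> carrier W" "t \<in> carrier W" "t \<in> S"
    using assms gens_closed by auto
  have "wprod (p @ t # q) \<otimes> t = wprod p \<otimes> (t \<otimes> (wprod q \<otimes> t))"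
    using c by (simp add: m_assoc)
  also have "wprod q \<otimes> t = t \<otimes> wprod q"
    using c assms(2) by (intro word_prod_commute) auto
  finally show ?thesis using c by (simp add: gen_square_cancel)
qed

lemma wprod_mult_letter:
  assumes "set ws \<subseteq> S" "t \<in> S"
  shows "wprod (mult_letter t ws) = wprod ws \<otimes> t" and "set (mult_letter t ws) \<subseteq> S"
proof -
  have "wprod (mult_letter t ws) = wprod ws \<otimes> t \<and> set (mult_letter t ws) \<subseteq> S"
  proof (cases "cancels t ws")
    case True
    then obtain p q where "ws = p @ t # q" "\<forall>x\<in>set q. commuting t x"
      by (auto simp: cancels_def)
    then show ?thesis using assms wprod_delete by (auto simp: mult_letter_cancel)
  next
    case False
    then show ?thesis
      using assms word_in_carrier gen_in_carrier by (auto simp: mult_letter_def)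
  qed
  then show "wprod (mult_letter t ws) = wprod ws \<otimes> t" "set (mult_letter t ws) \<subseteq> S" by auto
qed

text \<open>
  Two equal letters that can be brought together cancel, which would shorten the word.
\<close>

lemma reduced_imp_normal:
  assumes "reduced ws"
  shows "normal ws"
  unfolding normal_def
proof (intro allI impI notI)
  fix p t q assume ws: "ws = p @ t # q" and "cancels t p"
  then obtain p1 p2 where p: "p = p1 @ t # p2" and p2: "\<forall>x\<in>set p2. commuting t x"
    by (auto simp: cancels_def)
  have S: "set p \<subseteq> S" "set q \<subseteq> S" "t \<in> S" "set p1 \<subseteq> S" "set p2 \<subseteq> S"
    using reduced_set[OF assms] by (auto simp: ws p)
  have "wprod ws = wprod p \<otimes> t \<otimes> wprod q"
    using S word_in_carrier gen_in_carrier by (simp add: ws m_assoc)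
  also have "wprod p \<otimes> t = wprod (p1 @ p2)"
    using S p2 unfolding p by (intro wprod_delete) auto
  finally have "wprod ws = wprod (p1 @ p2 @ q)"
    using S word_in_carrier by (simp add: m_assoc)
  then have "len (wprod ws) \<le> length (p1 @ p2 @ q)"
    using len_le[of "p1 @ p2 @ q"] S by simp
  then show False using reduced_length[OF assms] by (simp add: ws p)
qed

end

context right_angled_coxeter_system
begin

text \<open>
  The normal form is an invariant of the group element.  In a right-angled system the defining
  relations are \<open>s s = 1\<close> and \<open>s t s t = 1\<close> for commuting \<open>s\<close> and \<open>t\<close>, and both act trivially on normal
  words by \<open>mult_letter_twice\<close> and \<open>mult_letter_commute\<close>.
\<close>

lemma coxeter_cong_trace_eq:
  "coxeter_cong W S u v \<Longrightarrow> trace_eq (normal_form_from [] u) (normal_form_from [] v)"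
proof (induction rule: coxeter_cong.induct)
  case (refl u)
  then show ?case by simp
next
  case (relation u v s t)
  define w where "w = normal_form_from [] u"
  have n: "normal w" by (simp add: w_def normal_normal_form_from)
  have step: "trace_eq (normal_form_from w (concat (replicate (ord (s \<otimes> t)) [s, t]))) w"
  proof -
    consider "ord (s \<otimes> t) = 0" | "ord (s \<otimes> t) = 1" | "ord (s \<otimes> t) = 2"
      using right_angled[OF relation(3,4)] by auto
    then show ?thesis
    proof cases
      case 1
      then show ?thesis by (simp add: normal_form_from_def)
    next
      case 2
      then have "s = t" using gen_ord_1 relation by blast
      then show ?thesis using 2 mult_letter_twice[OF n] by (simp add: normal_form_from_def)
    next
      case 3
      then have cm: "commuting s t" using ord_eq_2_iff_commuting relation by blast
      let ?m = mult_letter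
      have "trace_eq (?m t (?m s (?m t (?m s w)))) (?m t (?m t (?m s (?m s w))))"
        by (intro trace_eq_mult_letter mult_letter_commute cm)
      also have "trace_eq \<dots> (?m s (?m s w))"
        by (intro mult_letter_twice normal_mult_letter n)
      also have "trace_eq \<dots> w"
        by (rule mult_letter_twice[OF n])
      finally show ?thesis using 3
        by (simp add: normal_form_from_def numeral_2_eq_2)
    qed
  qed
  then show ?case
    by (simp add: normal_form_from_append flip: w_def) (rule normal_form_from_cong)
next
  case (sym u v)
  then show ?case by (simp add: trace_eq_sym)
next
  case (trans u v w)
  then show ?case using trace_eq_trans by blast
qed

lemma normal_trace_unique:
  assumes "normal u" "normal v" "set u \<subseteq> S" "set v \<subseteq> S" "wprod u = wprod v"
  shows "trace_eq u v"
  using coxeter_cong_trace_eq[OF presentation[OF assms(3,4,5)]] assms(1,2)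
  by (simp add: normal_form_from_normal)

text \<open>
  A normal word is its own normal form, so it has the same length as any reduced word of the element
  that it represents.
\<close>

lemma reduced_iff_normal: "reduced ws \<longleftrightarrow> set ws \<subseteq> S \<and> normal ws"
proof
  assume "reduced ws"
  then show "set ws \<subseteq> S \<and> normal ws" using reduced_imp_normal reduced_set by blast
next
  assume ws: "set ws \<subseteq> S \<and> normal ws"
  then obtain vs where vs: "reduced vs" "wprod vs = wprod ws"
    using reduced_word_exists word_in_carrier word_prod_closed by metis
  then have "length vs = length ws"
    using ws reduced_imp_normal reduced_set by (intro trace_eq_length normal_trace_unique) auto
  then show "reduced ws" using ws vs reduced_length[of vs] by (simp add: reduced_word_def)
qed

lemma reduced_count_list:
  "reduced u \<Longrightarrow> reduced v \<Longrightarrow> wprod u = wprod v \<Longrightarrow> count_list u x = count_list v x"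
  by (intro trace_eq_count_list normal_trace_unique) (auto simp: reduced_iff_normal)

lemma reduced_cancels_cong:
  "reduced u \<Longrightarrow> reduced v \<Longrightarrow> wprod u = wprod v \<Longrightarrow> cancels t u \<longleftrightarrow> cancels t v"
  by (intro trace_eq_cancels normal_trace_unique) (auto simp: reduced_iff_normal)

lemma reduced_prefix: "reduced (u @ v) \<Longrightarrow> reduced u"
  using normal_prefix by (auto simp: reduced_iff_normal)

lemma reduced_mult_letter: "reduced ws \<Longrightarrow> t \<in> S \<Longrightarrow> reduced (mult_letter t ws)"
  by (simp add: reduced_iff_normal normal_mult_letter wprod_mult_letter)

lemma reduced_replace_prefix:
  assumes "reduced (u @ v)" "reduced u'" "wprod u' = wprod u"
  shows "reduced (u' @ v)" and "wprod (u' @ v) = wprod (u @ v)"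
proof -
  have S: "set u \<subseteq> S" "set v \<subseteq> S" "set u' \<subseteq> S"
    using reduced_set[OF assms(1)] reduced_set[OF assms(2)] by auto
  then show eq: "wprod (u' @ v) = wprod (u @ v)" using word_in_carrier assms(3) by simp
  have "length u' = length u"
    using assms reduced_prefix[OF assms(1)] by (simp add: reduced_word_def)
  then show "reduced (u' @ v)" using S assms(1) eq by (simp add: reduced_word_def)
qed

lemma len_mult_gen:
  assumes "reduced ws" "t \<in> S"
  shows "len (wprod ws \<otimes> t) = (if cancels t ws then length ws - 1 else length ws + 1)"
proof -
  have "len (wprod ws \<otimes> t) = length (mult_letter t ws)"
    using reduced_length[OF reduced_mult_letter[OF assms]] assms reduced_set wprod_mult_letter
    by simp
  then show ?thesis
    by (auto simp: mult_letter_def length_remove1 cancels_def)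
qed

lemma reduced_move_to_end:
  assumes "reduced ws" "cancels t ws"
  obtains u where "reduced (u @ [t])" "wprod (u @ [t]) = wprod ws" "length ws = length u + 1"
proof -
  from assms(2) obtain p q where ws: "ws = p @ t # q" and q: "\<forall>x\<in>set q. commuting t x"
    by (auto simp: cancels_def)
  have S: "set p \<subseteq> S" "set q \<subseteq> S" "t \<in> S" using reduced_set[OF assms(1)] by (auto simp: ws)
  have eq: "wprod ((p @ q) @ [t]) = wprod ws"
    using S word_in_carrier gen_in_carrier word_prod_commute[OF _ _ q] by (simp add: ws m_assoc)
  then have "reduced ((p @ q) @ [t])"
    using reduced_length[OF assms(1)] S by (simp add: reduced_word_def ws)
  with eq show ?thesis by (intro that[of "p @ q"]) (auto simp: ws)
qed

section \<open>Firm elements\<close>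

lemma not_firmI:
  assumes "reduced u" "cancels s u" "cancels t u" "s \<noteq> t"
  shows "\<not> firm W S (wprod u)"
proof
  assume "firm W S (wprod u)"
  then obtain r where r: "\<And>ws. reduced ws \<Longrightarrow> wprod ws = wprod u \<Longrightarrow> last ws = r"
    by (auto simp: firm_def)
  have "x = r" if x: "cancels x u" for x
  proof -
    obtain v where "reduced (v @ [x])" "wprod (v @ [x]) = wprod u"
      using reduced_move_to_end[OF assms(1) x] by blast
    from r[OF this] show ?thesis by simp
  qed
  with assms show False by blast
qed

text \<open>
  Some reduced word of a non-firm element ends with a letter \<open>s\<close> other than \<open>r\<close>.  As \<open>r\<close> can still be
  moved to the end of this word, it moves past \<open>s\<close>; so the two letters commute.
\<close>

lemma not_firmE:
  assumes "reduced ws" "cancels r ws" "\<not> firm W S (wprod ws)"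
  obtains v s where "reduced (v @ [s])" "wprod (v @ [s]) = wprod ws" "length ws = length v + 1"
    "s \<noteq> r" "commuting r s" "cancels r v"
proof -
  have "r \<in> S" using reduced_set[OF assms(1)] assms(2) by (auto simp: cancels_def)
  with assms(3) obtain w where w: "reduced w" "wprod w = wprod ws" "w = [] \<or> last w \<noteq> r"
    by (auto simp: firm_def)
  have l: "length w = length ws" using w(1,2) assms(1) reduced_length by metis
  moreover have "ws \<noteq> []" using assms(2) by auto
  ultimately have "w \<noteq> []" by auto
  then obtain v s where vs: "w = v @ [s]" by (metis rev_exhaust)
  then have "s \<noteq> r" using w(3) by simp
  moreover have "cancels r (v @ [s])"
    using reduced_cancels_cong[OF assms(1) w(1)] w(2) assms(2) vs by simp
  ultimately show ?thesis using that w l by (auto simp: vs cancels_snoc)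
qed

text \<open>
  While the element is not firm, a last letter different from \<open>r\<close> can be split off.  What remains in
  the end is a firm element that contains every occurrence of \<open>r\<close>.
\<close>

lemma firm_part:
  "reduced ws \<Longrightarrow> cancels r ws \<Longrightarrow>
    \<exists>u v. reduced (u @ v) \<and> wprod (u @ v) = wprod ws \<and> firm W S (wprod u) \<and> r \<notin> set v"
proof (induction "length ws" arbitrary: ws)
  case 0
  then show ?case by simp
next
  case (Suc k)
  show ?case
  proof (cases "firm W S (wprod ws)")
    case True
    then show ?thesis using Suc.prems by (intro exI[of _ ws] exI[of _ "[]"]) simp
  next
    case False
    then obtain y s where y: "reduced (y @ [s])" "wprod (y @ [s]) = wprod ws"
        "length ws = length y + 1" "s \<noteq> r" "cancels r y"
      using not_firmE[OF Suc.prems] by metis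
    then obtain u v where uv: "reduced (u @ v)" "wprod (u @ v) = wprod y"
        "firm W S (wprod u)" "r \<notin> set v"
      using Suc.hyps(1)[of y] Suc.hyps(2) reduced_prefix by auto
    have "reduced ((u @ v) @ [s])" "wprod ((u @ v) @ [s]) = wprod ws"
      using reduced_replace_prefix[OF y(1) uv(1,2)] y(2) by auto
    with uv y(4) show ?thesis by (intro exI[of _ u] exI[of _ "v @ [s]"]) simp
  qed
qed

text \<open>
  Cutting the word after the last occurrence of \<open>s\<close> makes \<open>s\<close> a possible last letter, so
  \<open>firm_part\<close> shows that all occurrences of \<open>s\<close> lie in a firm prefix of some reduced word.
\<close>

lemma length_le_of_firm_prefixes_short:
  assumes "reduced ws"
    and short: "\<And>u v. reduced (u @ v) \<Longrightarrow> wprod (u @ v) = wprod ws \<Longrightarrow> firm W S (wprod u) \<Longrightarrow>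
      length u \<le> n"
  shows "length ws \<le> n * card S"
proof -
  have "count_list ws s \<le> n" for s
  proof (cases "s \<in> set ws")
    case True
    then obtain a b where ws: "ws = a @ s # b" and sb: "s \<notin> set b"
      using split_list_last by metis
    have red: "reduced ((a @ [s]) @ b)" using assms(1) ws by simp
    have c: "cancels s (a @ [s])" by (simp add: cancels_snoc)
    obtain u v where uv: "reduced (u @ v)" "wprod (u @ v) = wprod (a @ [s])"
        "firm W S (wprod u)" "s \<notin> set v"
      using firm_part[OF reduced_prefix[OF red] c] by blast
    have "reduced ((u @ v) @ b)" "wprod ((u @ v) @ b) = wprod ws"
      using reduced_replace_prefix[OF red uv(1,2)] ws by auto
    then have "length u \<le> n" using short[of u "v @ b"] uv(3) by simp
    moreover have "count_list ws s = count_list (a @ [s]) s"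
      using sb by (simp add: ws)
    moreover have "count_list (a @ [s]) s = count_list (u @ v) s"
      using uv(2)[symmetric] by (rule reduced_count_list[OF reduced_prefix[OF red] uv(1)])
    moreover have "count_list (u @ v) s = count_list u s" using uv(4) by simp
    ultimately show ?thesis using count_le_length[of u s] by simp
  qed simp
  then have "sum (count_list ws) S \<le> (\<Sum>s\<in>S. n)" by (intro sum_mono)
  moreover have "sum (count_list ws) S = length ws"
    using reduced_set[OF assms(1)] finite_gens by (rule sum_count_set)
  ultimately show ?thesis by (simp add: mult.commute)
qed

end

section \<open>Galleries\<close>

lemma adjacent_sym: "adjacent \<Delta> s c d \<longleftrightarrow> adjacent \<Delta> s d c"
  by (simp add: adjacent_def insert_commute)

lemma (in chamber_system) adjacentD:
  assumes "adjacent \<Delta> s c d"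
  shows "c \<in> chambers \<Delta>" "d \<in> chambers \<Delta>" "c \<noteq> d" "s \<in> S"
proof -
  have e: "{c, d} \<in> edges \<Delta>" "colour \<Delta> {c, d} = s" using assms by (auto simp: adjacent_def)
  then obtain a b where "{c, d} = {a, b}" "a \<in> chambers \<Delta>" "b \<in> chambers \<Delta>" "a \<noteq> b"
    using edges by blast
  then show "c \<in> chambers \<Delta>" "d \<in> chambers \<Delta>" "c \<noteq> d" by (auto simp: doubleton_eq_iff)
  show "s \<in> S" using e colours by blast
qed

lemma (in chamber_system) adjacent_trans:
  assumes "adjacent \<Delta> s x y" "adjacent \<Delta> s y z" "x \<noteq> z"
  shows "adjacent \<Delta> s x z"
proof (rule panel_complete[of s y])
  show "s \<in> S" "y \<in> chambers \<Delta>" using adjacentD[OF assms(1)] by auto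
  show "x \<in> panel \<Delta> s y" "z \<in> panel \<Delta> s y"
    using assms adjacent_sym[of \<Delta> s x y] by (auto simp: panel_def)
qed (use assms in simp)

lemma gallery_Nil: "gallery \<Delta> [] cs c d \<longleftrightarrow> cs = [c] \<and> d = c \<and> c \<in> chambers \<Delta>"
  by (cases cs) (auto simp: gallery_def)

lemma gallery_ends:
  assumes "gallery \<Delta> ws cs c d"
  shows "c \<in> chambers \<Delta>" and "d \<in> chambers \<Delta>"
proof -
  have "cs \<noteq> []" "set cs \<subseteq> chambers \<Delta>" "hd cs = c" "last cs = d"
    using assms by (auto simp: gallery_def)
  then show "c \<in> chambers \<Delta>" "d \<in> chambers \<Delta>" by auto
qed

lemma gallery_snoc:
  "gallery \<Delta> (ws @ [s]) cs c d \<longleftrightarrow>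
    d \<in> chambers \<Delta> \<and> (\<exists>cs' x. cs = cs' @ [d] \<and> gallery \<Delta> ws cs' c x \<and> adjacent \<Delta> s x d)"
    (is "?L \<longleftrightarrow> ?R")
proof
  assume L: ?L
  then have "cs \<noteq> []" by (auto simp: gallery_def)
  with L have cs: "cs = butlast cs @ [d]" by (auto simp: gallery_def)
  define cs' where "cs' = butlast cs"
  have cs2: "cs = cs' @ [d]" using cs by (simp add: cs'_def)
  have len: "length cs' = length ws + 1" using L by (simp add: gallery_def cs2)
  then have ne: "cs' \<noteq> []" by auto
  have adj: "adjacent \<Delta> ((ws @ [s]) ! i) ((cs' @ [d]) ! i) ((cs' @ [d]) ! Suc i)"
    if "i \<le> length ws" for i
    using L that by (simp add: gallery_def cs2)
  have "adjacent \<Delta> (ws ! i) (cs' ! i) (cs' ! Suc i)" if "i < length ws" for i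
    using adj[of i] that len by (simp add: nth_append)
  then have "gallery \<Delta> ws cs' c (last cs')"
    using L len ne by (auto simp: gallery_def cs2)
  moreover have "adjacent \<Delta> s (last cs') d"
    using adj[of "length ws"] len ne by (simp add: nth_append last_conv_nth)
  moreover have "d \<in> chambers \<Delta>" using L by (simp add: gallery_def cs2)
  ultimately show ?R using cs2 by blast
next
  assume ?R
  then obtain cs' x where d: "d \<in> chambers \<Delta>" and cs: "cs = cs' @ [d]"
    and g: "gallery \<Delta> ws cs' c x" and a: "adjacent \<Delta> s x d" by blast
  have len: "length cs' = length ws + 1" and ne: "cs' \<noteq> []" using g by (auto simp: gallery_def)
  have "adjacent \<Delta> ((ws @ [s]) ! i) (cs ! i) (cs ! Suc i)" if "i \<le> length ws" for i
  proof (cases "i = length ws")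
    case True
    then show ?thesis using g a len ne by (simp add: cs nth_append gallery_def last_conv_nth)
  next
    case False
    then show ?thesis using g that len by (simp add: cs nth_append gallery_def)
  qed
  then show ?L using g d len ne by (auto simp: gallery_def cs)
qed

lemma gallery_append:
  "gallery \<Delta> u as c e \<Longrightarrow> gallery \<Delta> v bs e d \<Longrightarrow> gallery \<Delta> (u @ v) (as @ tl bs) c d"
proof (induction v arbitrary: bs d rule: rev_induct)
  case Nil
  then show ?case by (simp add: gallery_Nil)
next
  case (snoc s v)
  then obtain bs' x where d: "d \<in> chambers \<Delta>" and bs: "bs = bs' @ [d]"
    and g: "gallery \<Delta> v bs' e x" and a: "adjacent \<Delta> s x d" by (auto simp: gallery_snoc)
  have "bs' \<noteq> []" using g by (auto simp: gallery_def)
  then have "as @ tl bs = (as @ tl bs') @ [d]" by (simp add: bs)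
  moreover have "gallery \<Delta> (u @ v) (as @ tl bs') c x" using snoc g by blast
  ultimately show ?case
    using gallery_snoc[of \<Delta> "u @ v" s "as @ tl bs" c d] d a by auto
qed

lemma gallery_split:
  assumes "gallery \<Delta> ws cs c d" "i \<le> length ws"
  shows "gallery \<Delta> (take i ws) (take (i + 1) cs) c (cs ! i)"
    and "gallery \<Delta> (drop i ws) (drop i cs) (cs ! i) d"
proof -
  have l: "length cs = length ws + 1" "set cs \<subseteq> chambers \<Delta>" "hd cs = c" "last cs = d"
    and a: "\<And>j. j < length ws \<Longrightarrow> adjacent \<Delta> (ws ! j) (cs ! j) (cs ! (j + 1))"
    using assms(1) by (auto simp: gallery_def)
  have "last (take (i + 1) cs) = cs ! i"
    using l assms(2) by (subst last_conv_nth) auto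
  moreover have "set (take (i + 1) cs) \<subseteq> chambers \<Delta>"
    using l(2) set_take_subset by fast
  ultimately show "gallery \<Delta> (take i ws) (take (i + 1) cs) c (cs ! i)"
    using l a assms(2) by (auto simp: gallery_def hd_take)
  have "set (drop i cs) \<subseteq> chambers \<Delta>"
    using l(2) set_drop_subset by fast
  then show "gallery \<Delta> (drop i ws) (drop i cs) (cs ! i) d"
    using l a assms(2) by (auto simp: gallery_def hd_drop_conv_nth)
qed

section \<open>The gallery distance\<close>

context right_angled_building
begin

abbreviation \<delta> :: "'c \<Rightarrow> 'c \<Rightarrow> 'w" where
  "\<delta> \<equiv> wdist \<Delta>"

abbreviation gdist :: "'c \<Rightarrow> 'c \<Rightarrow> nat" where
  "gdist \<equiv> gallery_dist \<Delta>"

lemma gallery_wdist: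
  assumes "gallery \<Delta> ws cs c d" "reduced ws"
  shows "\<delta> c d = wprod ws"
  using wdist_gallery[OF gallery_ends[OF assms(1)] assms(2)] assms(1) by blast

lemma wdist_word_exists:
  assumes "c \<in> chambers \<Delta>" "d \<in> chambers \<Delta>"
  obtains ws cs where "reduced ws" "wprod ws = \<delta> c d" "length ws = gdist c d"
    "gallery \<Delta> ws cs c d"
proof -
  obtain ws where ws: "reduced ws" "wprod ws = \<delta> c d"
    using reduced_word_exists wdist_closed[OF assms] by metis
  moreover have "length ws = gdist c d" using reduced_length ws by (simp add: gallery_dist_def)
  moreover obtain cs where "gallery \<Delta> ws cs c d" using wdist_gallery[OF assms ws(1)] ws(2) by auto
  ultimately show ?thesis using that by blast
qed

text \<open>
  In this case appending \<open>s\<close> to a reduced word of \<open>\<delta> c x\<close> gives a reduced word, and a minimal gallery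
  to \<open>x\<close> extends to one to \<open>y\<close>.
\<close>

lemma wdist_adjacent_up:
  assumes "c \<in> chambers \<Delta>" "adjacent \<Delta> s x y" "len (\<delta> c x \<otimes>\<^bsub>weyl \<Delta>\<^esub> s) > len (\<delta> c x)"
  shows "\<delta> c y = \<delta> c x \<otimes>\<^bsub>weyl \<Delta>\<^esub> s"
proof -
  note ad = adjacentD[OF assms(2)]
  obtain ws cs where ws: "reduced ws" "wprod ws = \<delta> c x" "gallery \<Delta> ws cs c x"
    using wdist_word_exists[OF assms(1) ad(1)] by metis
  have "\<not> cancels s ws"
    using len_mult_gen[OF ws(1) ad(4)] assms(3) reduced_length[OF ws(1)] ws(2)
    by (auto split: if_splits)
  then have red: "reduced (ws @ [s])"
    using reduced_mult_letter[OF ws(1) ad(4)] by (simp add: mult_letter_def)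
  have "gallery \<Delta> (ws @ [s]) (cs @ [y]) c y"
    using ws(3) assms(2) ad by (auto simp: gallery_snoc)
  then have "\<delta> c y = wprod (ws @ [s])" using red by (rule gallery_wdist)
  then show ?thesis
    using word_in_carrier[OF reduced_set[OF ws(1)]] gen_in_carrier[OF ad(4)] ws(2) by simp
qed

text \<open>
  If \<open>s\<close> shortens \<open>\<delta> c x\<close>, a minimal gallery to \<open>x\<close> can be chosen to enter \<open>x\<close> from a chamber \<open>p\<close> of
  the \<open>s\<close>-panel of \<open>x\<close>.  Either \<open>y\<close> is this chamber, or \<open>y\<close> is a neighbour of \<open>p\<close> farther from \<open>c\<close>,
  like \<open>x\<close>.
\<close>

lemma wdist_adjacent:
  assumes "c \<in> chambers \<Delta>" "adjacent \<Delta> s x y"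
  shows "\<delta> c y = \<delta> c x \<otimes>\<^bsub>weyl \<Delta>\<^esub> s \<or> \<delta> c y = \<delta> c x"
proof -
  note ad = adjacentD[OF assms(2)]
  obtain ws where ws: "reduced ws" "wprod ws = \<delta> c x"
    using wdist_word_exists[OF assms(1) ad(1)] by metis
  show ?thesis
  proof (cases "cancels s ws")
    case False
    then show ?thesis
      using wdist_adjacent_up[OF assms] len_mult_gen[OF ws(1) ad(4)] reduced_length[OF ws(1)] ws(2)
      by simp
  next
    case True
    then obtain u where u: "reduced (u @ [s])" "wprod (u @ [s]) = \<delta> c x"
      using reduced_move_to_end[OF ws(1)] ws(2) by metis
    then obtain cs where "gallery \<Delta> (u @ [s]) cs c x"
      using wdist_gallery[OF assms(1) ad(1) u(1)] by auto
    then obtain cs' p where p: "gallery \<Delta> u cs' c p" "adjacent \<Delta> s p x"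
      by (auto simp: gallery_snoc)
    have "\<delta> c p = wprod u" using p(1) reduced_prefix[OF u(1)] by (rule gallery_wdist)
    moreover have "wprod u \<otimes>\<^bsub>weyl \<Delta>\<^esub> s = \<delta> c x"
      using u word_in_carrier[of u] gen_in_carrier[OF ad(4)] reduced_set[OF u(1)] by simp
    ultimately have px: "\<delta> c p \<otimes>\<^bsub>weyl \<Delta>\<^esub> s = \<delta> c x" by simp
    have pc: "\<delta> c p \<in> carrier (weyl \<Delta>)" using wdist_closed assms(1) adjacentD(1)[OF p(2)] by blast
    then have xp: "\<delta> c x \<otimes>\<^bsub>weyl \<Delta>\<^esub> s = \<delta> c p"
      using gen_square_cancel_right[OF ad(4) pc] px by simp
    show ?thesis
    proof (cases "p = y")
      case True
      then show ?thesis using xp by simp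
    next
      case False
      then have py: "adjacent \<Delta> s p y" using adjacent_trans[OF p(2) assms(2)] by simp
      have "len (\<delta> c p) < len (\<delta> c x)"
        using \<open>\<delta> c p = wprod u\<close> u(2) reduced_length[OF u(1)]
          reduced_length[OF reduced_prefix[OF u(1)]] by simp
      then show ?thesis using wdist_adjacent_up[OF assms(1) py] px by simp
    qed
  qed
qed

lemma gdist_adjacent:
  assumes "c \<in> chambers \<Delta>" "adjacent \<Delta> s x y"
  shows "gdist c y \<le> gdist c x + 1"
proof -
  note ad = adjacentD[OF assms(2)]
  obtain ws where ws: "reduced ws" "wprod ws = \<delta> c x" "length ws = gdist c x"
    using wdist_word_exists[OF assms(1) ad(1)] by metis
  then show ?thesis
    using len_mult_gen[OF ws(1) ad(4)] wdist_adjacent[OF assms]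
    by (auto simp: gallery_dist_def split: if_splits)
qed

lemma wdist_adjacent_neq:
  assumes "c \<in> chambers \<Delta>" "adjacent \<Delta> s x y" "gdist c x \<noteq> gdist c y"
  shows "\<delta> c y = \<delta> c x \<otimes>\<^bsub>weyl \<Delta>\<^esub> s"
  using wdist_adjacent[OF assms(1,2)] assms(3) by (auto simp: gallery_dist_def)

text \<open>
  This turns the geometry of a panel into combinatorics of words: stepping closer along an edge of
  colour \<open>s\<close> means that \<open>s\<close> can be the last letter.
\<close>

lemma cancels_of_closer_neighbour:
  assumes "c \<in> chambers \<Delta>" "adjacent \<Delta> s x y" "gdist c y < gdist c x"
    and "reduced ws" "wprod ws = \<delta> c x"
  shows "cancels s ws"
proof -
  have "len (wprod ws \<otimes>\<^bsub>weyl \<Delta>\<^esub> s) < length ws"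
    using wdist_adjacent_neq[OF assms(1,2)] assms(3,4,5) reduced_length
    by (simp add: gallery_dist_def)
  then show ?thesis
    using len_mult_gen[OF assms(4) adjacentD(4)[OF assms(2)]] by (auto split: if_splits)
qed

text \<open>
  Every panel has a unique chamber nearest to \<open>c\<close>: seen from one nearest chamber, any other chamber
  of the panel is farther away by \<open>wdist_adjacent_up\<close>.
\<close>

lemma closer_neighbour_unique:
  assumes "c \<in> chambers \<Delta>" "adjacent \<Delta> s x y" "adjacent \<Delta> s x z"
    and "gdist c y < gdist c x" "gdist c z < gdist c x"
  shows "y = z"
proof (rule ccontr)
  assume "y \<noteq> z"
  have yx: "adjacent \<Delta> s y x" using assms(2) adjacent_sym by metis
  have yz: "adjacent \<Delta> s y z" using adjacent_trans[OF yx assms(3)] \<open>y \<noteq> z\<close> by simp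
  have x: "\<delta> c x = \<delta> c y \<otimes>\<^bsub>weyl \<Delta>\<^esub> s"
    using wdist_adjacent_neq[OF assms(1) yx] assms(4) by simp
  then have "\<delta> c z = \<delta> c x"
    using wdist_adjacent_up[OF assms(1) yz] assms(4) by (simp add: gallery_dist_def)
  then show False using assms(5) by (simp add: gallery_dist_def)
qed

lemma gdist_le_gallery:
  assumes "c \<in> chambers \<Delta>"
  shows "gallery \<Delta> ws cs e d \<Longrightarrow> gdist c d \<le> gdist c e + length ws"
proof (induction ws arbitrary: cs d rule: rev_induct)
  case Nil
  then show ?case by (simp add: gallery_Nil)
next
  case (snoc s ws)
  then obtain cs' x where g: "gallery \<Delta> ws cs' e x" "adjacent \<Delta> s x d"
    by (auto simp: gallery_snoc)
  then show ?case using snoc.IH[OF g(1)] gdist_adjacent[OF assms g(2)] by simp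
qed

lemma gdist_triangle:
  assumes "c \<in> chambers \<Delta>" "e \<in> chambers \<Delta>" "d \<in> chambers \<Delta>"
  shows "gdist c d \<le> gdist c e + gdist e d"
  using wdist_word_exists[OF assms(2,3)] gdist_le_gallery[OF assms(1)] by metis

lemma wdist_self: "c \<in> chambers \<Delta> \<Longrightarrow> \<delta> c c = \<one>\<^bsub>weyl \<Delta>\<^esub>"
  using gallery_wdist[of "[]" "[c]" c c] by (simp add: gallery_Nil reduced_iff_normal)

lemma gdist_self [simp]: "c \<in> chambers \<Delta> \<Longrightarrow> gdist c c = 0"
  using wdist_self len_le[of "[]"] by (simp add: gallery_dist_def)

lemma gdist_le_length: "gallery \<Delta> ws cs c d \<Longrightarrow> gdist c d \<le> length ws"
  using gdist_le_gallery[of c] gallery_ends(1) by fastforce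

lemma gdist_adjacent_le_1: "adjacent \<Delta> s x y \<Longrightarrow> gdist x y \<le> 1"
  using gdist_adjacent[of x s x y] adjacentD(1)[of s x y] by simp

lemma gdist_reverse_le:
  "gallery \<Delta> ws cs c d \<Longrightarrow> gdist d c \<le> length ws"
proof (induction ws arbitrary: cs d rule: rev_induct)
  case Nil
  then show ?case by (simp add: gallery_Nil)
next
  case (snoc s ws)
  then obtain cs' x where g: "gallery \<Delta> ws cs' c x" "adjacent \<Delta> s x d"
    by (auto simp: gallery_snoc)
  have "gdist d c \<le> gdist d x + gdist x c"
    using adjacentD[OF g(2)] gallery_ends[OF g(1)] gdist_triangle by blast
  moreover have "gdist d x \<le> 1" using gdist_adjacent_le_1 g(2) adjacent_sym by metis
  ultimately show ?case using snoc.IH[OF g(1)] by simp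
qed

lemma gdist_sym:
  assumes "c \<in> chambers \<Delta>" "d \<in> chambers \<Delta>"
  shows "gdist c d = gdist d c"
proof -
  have "gdist y x \<le> gdist x y" if "x \<in> chambers \<Delta>" "y \<in> chambers \<Delta>" for x y
    using wdist_word_exists[OF that] gdist_reverse_le by metis
  then show ?thesis using assms by (simp add: le_antisym)
qed

text \<open>
  Each step of a gallery increases the distance from its start by at most one, so in a minimal
  gallery every step increases it and multiplies the Weyl distance by the colour of the step.
\<close>

lemma minimal_gallery_reduced:
  "gallery \<Delta> ws cs c d \<Longrightarrow> length ws = gdist c d \<Longrightarrow> reduced ws \<and> wprod ws = \<delta> c d"
proof (induction ws arbitrary: cs d rule: rev_induct)
  case Nil
  then show ?case by (simp add: gallery_Nil wdist_self reduced_iff_normal)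
next
  case (snoc s ws)
  then obtain cs' x where g: "gallery \<Delta> ws cs' c x" "adjacent \<Delta> s x d"
    by (auto simp: gallery_snoc)
  have c: "c \<in> chambers \<Delta>" using gallery_ends(1)[OF g(1)] .
  note ad = adjacentD[OF g(2)]
  have l: "gdist c x = length ws"
    using gdist_le_length[OF g(1)] gdist_adjacent[OF c g(2)] snoc.prems(2) by simp
  then have IH: "reduced ws" "wprod ws = \<delta> c x" using snoc.IH[OF g(1)] by auto
  have "\<delta> c d = \<delta> c x \<otimes>\<^bsub>weyl \<Delta>\<^esub> s"
    using wdist_adjacent_neq[OF c g(2)] l snoc.prems(2) by simp
  then have p: "wprod (ws @ [s]) = \<delta> c d"
    using IH word_in_carrier[OF reduced_set[OF IH(1)]] gen_in_carrier[OF ad(4)] by simp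
  then show ?case
    using snoc.prems(2) reduced_set[OF IH(1)] ad(4) by (simp add: reduced_word_def gallery_dist_def)
qed

section \<open>Flexible chambers\<close>

text \<open>
  A chamber lies on some minimal gallery from \<open>c\<^sub>0\<close> to \<open>c\<close> iff it gives equality in the triangle
  inequality, and its position on the gallery is its distance from \<open>c\<^sub>0\<close>.  This removes galleries
  and indices from the definition of flexibility.
\<close>

lemma flexible_iff_between:
  assumes c0: "c\<^sub>0 \<in> chambers \<Delta>"
  shows "flexible \<Delta> c\<^sub>0 n c \<longleftrightarrow> c \<in> chambers \<Delta> \<and>
    (\<forall>e\<in>chambers \<Delta>. gdist c\<^sub>0 e + gdist e c = gdist c\<^sub>0 c \<longrightarrow> firm_chamber \<Delta> c\<^sub>0 e \<longrightarrow>
      gdist c\<^sub>0 e \<le> n)" (is "_ \<longleftrightarrow> ?R")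
proof
  assume f: "flexible \<Delta> c\<^sub>0 n c"
  then have c: "c \<in> chambers \<Delta>" by (auto simp: flexible_def gallery_ball_def)
  show ?R
  proof (intro conjI ballI impI)
    fix e assume e: "e \<in> chambers \<Delta>" "gdist c\<^sub>0 e + gdist e c = gdist c\<^sub>0 c" "firm_chamber \<Delta> c\<^sub>0 e"
    show "gdist c\<^sub>0 e \<le> n"
    proof (rule ccontr)
      assume big: "\<not> gdist c\<^sub>0 e \<le> n"
      obtain u as where u: "length u = gdist c\<^sub>0 e" "gallery \<Delta> u as c\<^sub>0 e"
        using wdist_word_exists[OF c0 e(1)] by metis
      obtain v bs where v: "length v = gdist e c" "gallery \<Delta> v bs e c"
        using wdist_word_exists[OF e(1) c] by metis
      have "gallery \<Delta> (u @ v) (as @ tl bs) c\<^sub>0 c" using u(2) v(2) by (rule gallery_append)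
      then have m: "minimal_gallery \<Delta> (as @ tl bs) c\<^sub>0 c"
        unfolding minimal_gallery_def using u v e(2) by (metis length_append)
      have "length as = length u + 1" "last as = e" using u(2) by (auto simp: gallery_def)
      moreover from this have "as \<noteq> []" by auto
      ultimately have "(as @ tl bs) ! gdist c\<^sub>0 e = e"
        using u(1) by (simp add: nth_append last_conv_nth)
      moreover have "gdist c\<^sub>0 e \<in> {n + 1..gdist c\<^sub>0 c}" using big e(2) by simp
      moreover have "\<not> gdist c\<^sub>0 c \<le> n" using big e(2) by simp
      ultimately show False
        using f m e(3) unfolding flexible_def gallery_ball_def by fastforce
    qed
  qed (rule c)
next
  assume R: ?R
  show "flexible \<Delta> c\<^sub>0 n c"
  proof (cases "gdist c\<^sub>0 c \<le> n")
    case True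
    then show ?thesis using R by (simp add: flexible_def gallery_ball_def)
  next
    case False
    have "\<not> firm_chamber \<Delta> c\<^sub>0 (cs ! i)"
      if m: "minimal_gallery \<Delta> cs c\<^sub>0 c" and i: "i \<in> {n + 1..gdist c\<^sub>0 c}" for cs i
    proof
      assume firm: "firm_chamber \<Delta> c\<^sub>0 (cs ! i)"
      obtain ws where ws: "gallery \<Delta> ws cs c\<^sub>0 c" "length ws = gdist c\<^sub>0 c"
        using m by (auto simp: minimal_gallery_def)
      have il: "i \<le> length ws" using i ws by simp
      have e: "cs ! i \<in> chambers \<Delta>"
        using ws(1) il by (auto simp: gallery_def)
      have "gdist c\<^sub>0 (cs ! i) \<le> i" "gdist (cs ! i) c \<le> gdist c\<^sub>0 c - i"
        using gdist_le_length[OF gallery_split(1)[OF ws(1) il]]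
          gdist_le_length[OF gallery_split(2)[OF ws(1) il]] il ws(2) by auto
      moreover have "gdist c\<^sub>0 c \<le> gdist c\<^sub>0 (cs ! i) + gdist (cs ! i) c"
        using gdist_triangle c0 e R by blast
      moreover have "i \<le> gdist c\<^sub>0 c" "n < i" using i by auto
      ultimately have "gdist c\<^sub>0 (cs ! i) + gdist (cs ! i) c = gdist c\<^sub>0 c" "gdist c\<^sub>0 (cs ! i) > n"
        by linarith+
      then show False using R e firm by fastforce
    qed
    then show ?thesis using False R by (simp add: flexible_def)
  qed
qed

lemma flexible_between:
  assumes c0: "c\<^sub>0 \<in> chambers \<Delta>" and f: "flexible \<Delta> c\<^sub>0 n c"
    and x: "x \<in> chambers \<Delta>" "gdist c\<^sub>0 x + gdist x c \<le> gdist c\<^sub>0 c"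
  shows "flexible \<Delta> c\<^sub>0 n x"
  unfolding flexible_iff_between[OF c0]
proof (intro conjI ballI impI)
  fix e assume e: "e \<in> chambers \<Delta>" "gdist c\<^sub>0 e + gdist e x = gdist c\<^sub>0 x" "firm_chamber \<Delta> c\<^sub>0 e"
  have c: "c \<in> chambers \<Delta>" using f flexible_iff_between[OF c0] by blast
  have "gdist c\<^sub>0 c \<le> gdist c\<^sub>0 e + gdist e c" "gdist e c \<le> gdist e x + gdist x c"
    using gdist_triangle c0 e(1) x(1) c by auto
  then have "gdist c\<^sub>0 e + gdist e c = gdist c\<^sub>0 c" using e(2) x(2) by linarith
  then show "gdist c\<^sub>0 e \<le> n" using f e flexible_iff_between[OF c0] by blast
qed (rule x(1))

text \<open>
  A minimal gallery from \<open>e\<close> to \<open>x\<close> can be chosen to enter \<open>x\<close> through its \<open>t\<close>-panel, hence through the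
  chamber of this panel that is nearest to \<open>c\<^sub>0\<close>.  By uniqueness this chamber is \<open>y\<close>.
\<close>

lemma between_closer_neighbour:
  assumes ch: "c\<^sub>0 \<in> chambers \<Delta>" "e \<in> chambers \<Delta>"
    and between: "gdist c\<^sub>0 e + gdist e x = gdist c\<^sub>0 x"
    and adj: "adjacent \<Delta> t x y" and closer: "gdist c\<^sub>0 y < gdist c\<^sub>0 x"
    and v: "reduced v" "wprod v = \<delta> e x" "cancels t v"
  shows "gdist c\<^sub>0 e + gdist e y = gdist c\<^sub>0 y"
proof -
  note ad = adjacentD[OF adj]
  obtain u where u: "reduced (u @ [t])" "wprod (u @ [t]) = \<delta> e x" "length v = length u + 1"
    using reduced_move_to_end[OF v(1,3)] v(2) by metis
  obtain cs where "gallery \<Delta> (u @ [t]) cs e x"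
    using wdist_gallery[OF ch(2) ad(1) u(1)] u(2) by auto
  then obtain cs' z where z: "gallery \<Delta> u cs' e z" "adjacent \<Delta> t z x"
    by (auto simp: gallery_snoc)
  have lv: "gdist e x = length u + 1"
    using reduced_length[OF v(1)] v(2) u(3) by (simp add: gallery_dist_def)
  have "gdist c\<^sub>0 z \<le> gdist c\<^sub>0 e + length u" using gdist_le_gallery[OF ch(1) z(1)] .
  then have "gdist c\<^sub>0 z < gdist c\<^sub>0 x" using between lv by simp
  then have "z = y"
    using closer_neighbour_unique[OF ch(1) _ adj _ closer] z(2) adjacent_sym by metis
  then have "gdist e y \<le> length u" using gdist_le_length z(1) by blast
  moreover have "gdist c\<^sub>0 y \<le> gdist c\<^sub>0 e + gdist e y" using gdist_triangle ch ad by blast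
  moreover have "gdist c\<^sub>0 x \<le> gdist c\<^sub>0 y + 1"
    using gdist_adjacent[OF ch(1)] adj adjacent_sym by metis
  ultimately show ?thesis using between lv closer by linarith
qed

section \<open>The square closure of a ball\<close>

lemma Flex_closed_under_squares:
  assumes c0: "c\<^sub>0 \<in> chambers \<Delta>"
  shows "closed_under_squares \<Delta> c\<^sub>0 (Flex \<Delta> c\<^sub>0 n)"
proof -
  have square: "flexible \<Delta> c\<^sub>0 n c\<^sub>3"
    if st: "s \<noteq> t" and f: "flexible \<Delta> c\<^sub>0 n c\<^sub>1" "flexible \<Delta> c\<^sub>0 n c\<^sub>2"
      and a: "adjacent \<Delta> t c\<^sub>3 c\<^sub>1" "adjacent \<Delta> s c\<^sub>3 c\<^sub>2"
      and d: "gdist c\<^sub>0 c\<^sub>1 < gdist c\<^sub>0 c\<^sub>3" "gdist c\<^sub>0 c\<^sub>2 < gdist c\<^sub>0 c\<^sub>3"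
    for s t c\<^sub>1 c\<^sub>2 c\<^sub>3
    unfolding flexible_iff_between[OF c0]
  proof (intro conjI ballI impI)
    show c3: "c\<^sub>3 \<in> chambers \<Delta>" using adjacentD[OF a(1)] by blast
    fix e assume e: "e \<in> chambers \<Delta>" "gdist c\<^sub>0 e + gdist e c\<^sub>3 = gdist c\<^sub>0 c\<^sub>3"
      "firm_chamber \<Delta> c\<^sub>0 e"
    obtain u as where u: "reduced u" "wprod u = \<delta> c\<^sub>0 e" "length u = gdist c\<^sub>0 e"
        "gallery \<Delta> u as c\<^sub>0 e"
      using wdist_word_exists[OF c0 e(1)] by metis
    obtain v bs where v: "reduced v" "wprod v = \<delta> e c\<^sub>3" "length v = gdist e c\<^sub>3"
        "gallery \<Delta> v bs e c\<^sub>3"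
      using wdist_word_exists[OF e(1) c3] by metis
    have uv: "reduced (u @ v)" "wprod (u @ v) = \<delta> c\<^sub>0 c\<^sub>3"
      using minimal_gallery_reduced[OF gallery_append[OF u(4) v(4)]] u(3) v(3) e(2) by auto
    have "cancels t (u @ v)" "cancels s (u @ v)"
      using cancels_of_closer_neighbour[OF c0 a(1) d(1) uv]
        cancels_of_closer_neighbour[OF c0 a(2) d(2) uv] by auto
    moreover have "\<not> (cancels s u \<and> cancels t u)"
      using not_firmI[OF u(1)] st e(3) u(2) by (auto simp: firm_chamber_def)
    ultimately consider "cancels t v" | "cancels s v" by (auto simp: cancels_append)
    then show "gdist c\<^sub>0 e \<le> n"
    proof cases
      case 1
      then have "gdist c\<^sub>0 e + gdist e c\<^sub>1 = gdist c\<^sub>0 c\<^sub>1"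
        using between_closer_neighbour[OF c0 e(1,2) a(1) d(1) v(1,2)] by blast
      then show ?thesis using f(1) e flexible_iff_between[OF c0] by blast
    next
      case 2
      then have "gdist c\<^sub>0 e + gdist e c\<^sub>2 = gdist c\<^sub>0 c\<^sub>2"
        using between_closer_neighbour[OF c0 e(1,2) a(2) d(2) v(1,2)] by blast
      then show ?thesis using f(2) e flexible_iff_between[OF c0] by blast
    qed
  qed
  show ?thesis
    unfolding closed_under_squares_def
  proof (intro allI ballI impI)
    fix m s t c\<^sub>1 c\<^sub>2 c\<^sub>4 c\<^sub>3
    assume "c\<^sub>1 \<in> Flex \<Delta> c\<^sub>0 n \<inter> gallery_sphere \<Delta> c\<^sub>0 m"
      and "c\<^sub>2 \<in> Flex \<Delta> c\<^sub>0 n \<inter> gallery_sphere \<Delta> c\<^sub>0 m"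
      and "c\<^sub>3 \<in> gallery_sphere \<Delta> c\<^sub>0 (m + 1)"
      and "s \<noteq> t \<and> ord (s \<otimes>\<^bsub>weyl \<Delta>\<^esub> t) = 2 \<and>
        adjacent \<Delta> s c\<^sub>4 c\<^sub>1 \<and> adjacent \<Delta> t c\<^sub>4 c\<^sub>2 \<and>
        adjacent \<Delta> t c\<^sub>3 c\<^sub>1 \<and> adjacent \<Delta> s c\<^sub>3 c\<^sub>2"
    then show "c\<^sub>3 \<in> Flex \<Delta> c\<^sub>0 n"
      using square[of s t c\<^sub>1 c\<^sub>2 c\<^sub>3] by (simp add: Flex_def gallery_sphere_def)
  qed
qed

text \<open>
  The word of a non-firm chamber can be written as \<open>u r s\<close> and as \<open>u s r\<close> with commuting letters.
  Following the first word backwards from \<open>c\<close> gives \<open>c\<^sub>1\<close> and \<open>c\<^sub>4\<close>; a gallery of type \<open>s r\<close> from \<open>c\<^sub>4\<close>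
  to \<open>c\<close> gives \<open>c\<^sub>2\<close>.  The distance must be positive because \<open>c\<^sub>0\<close> itself counts as not firm.
\<close>

lemma square_below_non_firm:
  assumes c0: "c\<^sub>0 \<in> chambers \<Delta>" and c: "c \<in> chambers \<Delta>" "gdist c\<^sub>0 c > 0"
    and nf: "\<not> firm_chamber \<Delta> c\<^sub>0 c"
  obtains r s c\<^sub>1 c\<^sub>2 c\<^sub>4 where "commuting r s" "r \<in> gens \<Delta>" "s \<in> gens \<Delta>"
    "adjacent \<Delta> r c\<^sub>4 c\<^sub>1" "adjacent \<Delta> s c\<^sub>4 c\<^sub>2" "adjacent \<Delta> s c c\<^sub>1" "adjacent \<Delta> r c c\<^sub>2"
    "gdist c\<^sub>0 c\<^sub>1 + 1 = gdist c\<^sub>0 c" "gdist c\<^sub>0 c\<^sub>2 + 1 = gdist c\<^sub>0 c" "gdist c\<^sub>0 c\<^sub>4 + 2 = gdist c\<^sub>0 c"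
proof -
  obtain w where w: "reduced w" "wprod w = \<delta> c\<^sub>0 c" "length w = gdist c\<^sub>0 c"
    using wdist_word_exists[OF c0 c(1)] by metis
  then have "w \<noteq> []" using c(2) by auto
  then obtain w' r where "w = w' @ [r]" by (metis rev_exhaust)
  then have "cancels r w" by (simp add: cancels_snoc)
  moreover have "\<not> firm (weyl \<Delta>) (gens \<Delta>) (wprod w)"
    using nf w(2) by (simp add: firm_chamber_def)
  ultimately obtain y s where y: "reduced (y @ [s])" "wprod (y @ [s]) = \<delta> c\<^sub>0 c"
      "length w = length y + 1" "commuting r s" "cancels r y"
    using not_firmE[OF w(1)] w(2) by metis
  obtain u where u: "reduced (u @ [r])" "wprod (u @ [r]) = wprod y" "length y = length u + 1"
    using reduced_move_to_end[OF reduced_prefix[OF y(1)] y(5)] by metis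
  have red: "reduced ((u @ [r]) @ [s])" "wprod ((u @ [r]) @ [s]) = \<delta> c\<^sub>0 c"
    using reduced_replace_prefix[OF y(1) u(1,2)] y(2) by auto
  have rs: "r \<in> gens \<Delta>" "s \<in> gens \<Delta>" using reduced_set[OF red(1)] by auto
  obtain cs where "gallery \<Delta> ((u @ [r]) @ [s]) cs c\<^sub>0 c"
    using wdist_gallery[OF c0 c(1) red(1)] red(2) by auto
  then obtain cs1 c\<^sub>1 cs4 c\<^sub>4 where g: "gallery \<Delta> (u @ [r]) cs1 c\<^sub>0 c\<^sub>1" "adjacent \<Delta> s c\<^sub>1 c"
      "gallery \<Delta> u cs4 c\<^sub>0 c\<^sub>4" "adjacent \<Delta> r c\<^sub>4 c\<^sub>1"
    by (metis gallery_snoc)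
  have c4: "c\<^sub>4 \<in> chambers \<Delta>" "c\<^sub>1 \<in> chambers \<Delta>" using adjacentD[OF g(4)] by auto
  have "r \<noteq> s" using y(4) by auto
  then have "reduced [r, s]" "reduced [s, r]"
    using rs normal_snoc[of "[r]" s] normal_snoc[of "[s]" r] normal_snoc[of "[]" s]
      normal_snoc[of "[]" r]
    by (auto simp: reduced_iff_normal)
  moreover have "gallery \<Delta> ([r] @ [s]) [c\<^sub>4, c\<^sub>1, c] c\<^sub>4 c"
    using g c4 c(1) gallery_snoc[of \<Delta> "[r]" s "[c\<^sub>4, c\<^sub>1, c]"] gallery_snoc[of \<Delta> "[]" r "[c\<^sub>4, c\<^sub>1]"]
    by (auto simp: gallery_Nil)
  ultimately have "\<delta> c\<^sub>4 c = wprod [r, s]" using gallery_wdist[of "[r, s]"] by simp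
  also have "\<dots> = wprod [s, r]" using y(4) rs gen_in_carrier by (simp add: commuting_def)
  finally obtain ds where "gallery \<Delta> ([s] @ [r]) ds c\<^sub>4 c"
    using wdist_gallery[OF c4(1) c(1) \<open>reduced [s, r]\<close>] by auto
  then obtain ds' c\<^sub>2 where "gallery \<Delta> ([] @ [s]) ds' c\<^sub>4 c\<^sub>2" and g2: "adjacent \<Delta> r c\<^sub>2 c"
    by (metis gallery_snoc append_Nil)
  then have g3: "adjacent \<Delta> s c\<^sub>4 c\<^sub>2" by (auto simp: gallery_snoc gallery_Nil simp del: append_Nil)
  have "gdist c\<^sub>0 c\<^sub>4 \<le> length u" using gdist_le_length[OF g(3)] .
  moreover have "gdist c\<^sub>0 c = length u + 2" using w(3) y(3) u(3) by simp
  moreover note gdist_adjacent[OF c0 g(2)] gdist_adjacent[OF c0 g(4)]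
    gdist_adjacent[OF c0 g2] gdist_adjacent[OF c0 g3]
  ultimately have "gdist c\<^sub>0 c\<^sub>1 + 1 = gdist c\<^sub>0 c" "gdist c\<^sub>0 c\<^sub>2 + 1 = gdist c\<^sub>0 c"
    "gdist c\<^sub>0 c\<^sub>4 + 2 = gdist c\<^sub>0 c" by linarith+
  then show ?thesis
    using that y(4) rs g g2 g3 adjacent_sym by metis
qed

lemma flexible_in_closed_set:
  assumes c0: "c\<^sub>0 \<in> chambers \<Delta>"
    and D: "gallery_ball \<Delta> c\<^sub>0 n \<subseteq> D" "closed_under_squares \<Delta> c\<^sub>0 D"
  shows "flexible \<Delta> c\<^sub>0 n c \<Longrightarrow> c \<in> D"
proof (induction "gdist c\<^sub>0 c" arbitrary: c rule: less_induct)
  case less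
  have c: "c \<in> chambers \<Delta>" using less.prems flexible_iff_between[OF c0] by blast
  show ?case
  proof (cases "gdist c\<^sub>0 c \<le> n")
    case True
    then show ?thesis using D(1) c by (auto simp: gallery_ball_def)
  next
    case False
    then have pos: "gdist c\<^sub>0 c > 0" by simp
    \<comment> \<open>The chamber \<open>c\<close> is itself between \<open>c\<^sub>0\<close> and \<open>c\<close>.\<close>
    have "\<not> firm_chamber \<Delta> c\<^sub>0 c"
      using False less.prems c flexible_iff_between[OF c0] by fastforce
    then obtain r s c\<^sub>1 c\<^sub>2 c\<^sub>4 where rs: "commuting r s" "r \<in> gens \<Delta>" "s \<in> gens \<Delta>"
      and a: "adjacent \<Delta> r c\<^sub>4 c\<^sub>1" "adjacent \<Delta> s c\<^sub>4 c\<^sub>2" "adjacent \<Delta> s c c\<^sub>1" "adjacent \<Delta> r c c\<^sub>2"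
      and d: "gdist c\<^sub>0 c\<^sub>1 + 1 = gdist c\<^sub>0 c" "gdist c\<^sub>0 c\<^sub>2 + 1 = gdist c\<^sub>0 c"
        "gdist c\<^sub>0 c\<^sub>4 + 2 = gdist c\<^sub>0 c"
      by (rule square_below_non_firm[OF c0 c pos])
    have ch: "c\<^sub>1 \<in> chambers \<Delta>" "c\<^sub>2 \<in> chambers \<Delta>" "c\<^sub>4 \<in> chambers \<Delta>"
      using adjacentD[OF a(1)] adjacentD[OF a(2)] by auto
    have d1: "gdist c\<^sub>1 c \<le> 1" "gdist c\<^sub>2 c \<le> 1" "gdist c\<^sub>4 c\<^sub>1 \<le> 1"
      using gdist_adjacent_le_1 a adjacent_sym by metis+
    moreover have "gdist c\<^sub>4 c \<le> gdist c\<^sub>4 c\<^sub>1 + gdist c\<^sub>1 c" using gdist_triangle ch c by blast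
    ultimately have "flexible \<Delta> c\<^sub>0 n c\<^sub>1" "flexible \<Delta> c\<^sub>0 n c\<^sub>2" "flexible \<Delta> c\<^sub>0 n c\<^sub>4"
      using flexible_between[OF c0 less.prems] ch d by auto
    then have "c\<^sub>1 \<in> D" "c\<^sub>2 \<in> D" "c\<^sub>4 \<in> D" using less.hyps d by auto
    moreover define m where "m = gdist c\<^sub>0 c\<^sub>1"
    ultimately have "c\<^sub>1 \<in> D \<inter> gallery_sphere \<Delta> c\<^sub>0 m" "c\<^sub>2 \<in> D \<inter> gallery_sphere \<Delta> c\<^sub>0 m"
        "c\<^sub>4 \<in> D \<inter> gallery_sphere \<Delta> c\<^sub>0 (m - 1)" "c \<in> gallery_sphere \<Delta> c\<^sub>0 (m + 1)" "m \<ge> 1"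
      using ch c d by (auto simp: gallery_sphere_def)
    moreover have "ord (r \<otimes>\<^bsub>weyl \<Delta>\<^esub> s) = 2" "r \<noteq> s"
      using rs ord_eq_2_iff_commuting by (auto simp: commuting_def)
    ultimately show ?thesis
      using D(2) a rs(2,3) unfolding closed_under_squares_def by blast
  qed
qed

lemma flexible_gdist_le:
  assumes c0: "c\<^sub>0 \<in> chambers \<Delta>" and f: "flexible \<Delta> c\<^sub>0 n c"
  shows "gdist c\<^sub>0 c \<le> n * card (gens \<Delta>)"
proof -
  have c: "c \<in> chambers \<Delta>" using f flexible_iff_between[OF c0] by blast
  obtain ws where ws: "reduced ws" "wprod ws = \<delta> c\<^sub>0 c" "length ws = gdist c\<^sub>0 c"
    using wdist_word_exists[OF c0 c] by metis
  have "length ws \<le> n * card (gens \<Delta>)"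
  proof (rule length_le_of_firm_prefixes_short[OF ws(1)])
    fix u v assume uv: "reduced (u @ v)" "wprod (u @ v) = wprod ws"
      and firm: "firm (weyl \<Delta>) (gens \<Delta>) (wprod u)"
    obtain cs where g: "gallery \<Delta> (u @ v) cs c\<^sub>0 c"
      using wdist_gallery[OF c0 c uv(1)] uv(2) ws(2) by auto
    define e where "e = cs ! length u"
    have g1: "gallery \<Delta> u (take (length u + 1) cs) c\<^sub>0 e" and g2: "gallery \<Delta> v (drop (length u) cs) e c"
      using gallery_split[OF g, of "length u"] by (auto simp: e_def)
    have e: "e \<in> chambers \<Delta>" using g by (auto simp: gallery_def e_def)
    have eu: "\<delta> c\<^sub>0 e = wprod u" using gallery_wdist[OF g1 reduced_prefix[OF uv(1)]] .
    then have du: "gdist c\<^sub>0 e = length u"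
      using reduced_length[OF reduced_prefix[OF uv(1)]] by (simp add: gallery_dist_def)
    have "length (u @ v) = gdist c\<^sub>0 c"
      using reduced_length[OF uv(1)] uv(2) ws(2) by (simp add: gallery_dist_def)
    then have "gdist c\<^sub>0 e + gdist e c \<le> gdist c\<^sub>0 c" using du gdist_le_length[OF g2] by simp
    then have "gdist c\<^sub>0 e + gdist e c = gdist c\<^sub>0 c" using gdist_triangle[OF c0 e c] by simp
    then show "length u \<le> n"
      using f e firm eu du flexible_iff_between[OF c0] by (auto simp: firm_chamber_def)
  qed
  then show ?thesis using ws(3) by simp
qed

lemma Flex_bounded:
  assumes c0: "c\<^sub>0 \<in> chambers \<Delta>"
  shows "gallery_bounded \<Delta> (Flex \<Delta> c\<^sub>0 n)"
  unfolding gallery_bounded_def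
proof (intro exI ballI)
  fix c d assume "c \<in> Flex \<Delta> c\<^sub>0 n" "d \<in> Flex \<Delta> c\<^sub>0 n"
  then have f: "flexible \<Delta> c\<^sub>0 n c" "flexible \<Delta> c\<^sub>0 n d" by (auto simp: Flex_def)
  then have ch: "c \<in> chambers \<Delta>" "d \<in> chambers \<Delta>" using flexible_iff_between[OF c0] by auto
  have "gdist c d \<le> gdist c\<^sub>0 c + gdist c\<^sub>0 d"
    using gdist_triangle[OF ch(1) c0 ch(2)] gdist_sym[OF ch(1) c0] by simp
  then show "gdist c d \<le> 2 * (n * card (gens \<Delta>))"
    using flexible_gdist_le[OF c0 f(1)] flexible_gdist_le[OF c0 f(2)] by simp
qed

lemma square_closure_ball:
  assumes c0: "c\<^sub>0 \<in> chambers \<Delta>"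
  shows "square_closure \<Delta> c\<^sub>0 (gallery_ball \<Delta> c\<^sub>0 n) = Flex \<Delta> c\<^sub>0 n"
proof
  have "gallery_ball \<Delta> c\<^sub>0 n \<subseteq> Flex \<Delta> c\<^sub>0 n" by (auto simp: Flex_def flexible_def)
  moreover have "Flex \<Delta> c\<^sub>0 n \<subseteq> chambers \<Delta>"
    using flexible_iff_between[OF c0] by (auto simp: Flex_def)
  ultimately show "square_closure \<Delta> c\<^sub>0 (gallery_ball \<Delta> c\<^sub>0 n) \<subseteq> Flex \<Delta> c\<^sub>0 n"
    unfolding square_closure_def
    using Flex_closed_under_squares[OF c0] by (intro hull_minimal) auto
  show "Flex \<Delta> c\<^sub>0 n \<subseteq> square_closure \<Delta> c\<^sub>0 (gallery_ball \<Delta> c\<^sub>0 n)"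
    unfolding square_closure_def hull_def
    using flexible_in_closed_set[OF c0] by (auto simp: Flex_def)
qed

end

theorem theorem3p17:
  fixes \<Delta> :: "('c, 'w) building" and c\<^sub>0 :: 'c and n :: nat
  assumes "right_angled_building \<Delta>"
    and "c\<^sub>0 \<in> chambers \<Delta>"
  shows "square_closure \<Delta> c\<^sub>0 (gallery_ball \<Delta> c\<^sub>0 n) = Flex \<Delta> c\<^sub>0 n
    \<and> gallery_bounded \<Delta> (Flex \<Delta> c\<^sub>0 n)"
  using right_angled_building.square_closure_ball[OF assms]
    right_angled_building.Flex_bounded[OF assms] by blast

end
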